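(* Let $G$ be an $n\times n$ grid with $n$ even. Every non-partitive initial configuration of $k\ge3$ robots on distinct nodes of $G$ in which all four corners of the minimum enclosing square are occupied is gatherable despite at most one crash fault.
   Context: Model. The grid is the anonymous grid graph. A configuration is $f:V(G)\to\{0,1,2\}$ ($0$ empty, $1$ singleton, $2$ multiplicity). Robots are anonymous, identical, oblivious, cannot communicate, share no coordinate system, orientation or chirality, run the same deterministic algorithm in Look–Compute–Move cycles (snapshot of the whole configuration with weak multiplicity detection; decision; instantaneous move to an adjacent node or stay), fully asynchronously (finite but unbounded adversarial delays; every non-crashed robot activated infinitely often). At most one robot may crash at an adversarial time (stops forever, stays visible, indistinguishable). Gatherable despite at most one crash fault: some such algorithm guarantees in every execution with at most one crash that after finite time all non-crashed robots are on one node and remain there. Partitive: some automorphism $\varphi$ of $(G,f)$ (graph automorphism with $f\circ\varphi=f$) of order $p>1$ has all orbits of $V(G)$ under $\langle\varphi\rangle$ of size exactly $p$. Minimum enclosing square: smallest square subgrid with the same geometric center as the grid containing all occupied nodes; its corners are its four corner nodes. *)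

theory Defs
  imports Main
begin

type_synonym node = "nat \<times> nat"
type_synonym config = "node \<Rightarrow> nat"  \<comment> \<open>0 empty, 1 singleton, 2 multiplicity\<close>

definition grid_nodes :: "nat \<Rightarrow> node set" where
  "grid_nodes n = {0..<n} \<times> {0..<n}"

definition grid_adj :: "node \<Rightarrow> node \<Rightarrow> bool" where
  "grid_adj u v \<longleftrightarrow> \<bar>int (fst u) - int (fst v)\<bar> + \<bar>int (snd u) - int (snd v)\<bar> = 1"

definition grid_aut :: "nat \<Rightarrow> (node \<Rightarrow> node) \<Rightarrow> bool" where
  "grid_aut n \<phi> \<longleftrightarrow> bij_betw \<phi> (grid_nodes n) (grid_nodes n) \<and>
     (\<forall>u\<in>grid_nodes n. \<forall>v\<in>grid_nodes n. grid_adj (\<phi> u) (\<phi> v) \<longleftrightarrow> grid_adj u v)"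

definition partitive :: "nat \<Rightarrow> config \<Rightarrow> bool" where
  "partitive n f \<longleftrightarrow> (\<exists>\<phi> p. grid_aut n \<phi> \<and> (\<forall>v\<in>grid_nodes n. f (\<phi> v) = f v) \<and> p > 1 \<and>
     (\<forall>v\<in>grid_nodes n. (\<phi> ^^ p) v = v) \<and>
     (\<forall>q. 0 < q \<and> q < p \<longrightarrow> \<not> (\<forall>v\<in>grid_nodes n. (\<phi> ^^ q) v = v)) \<and>
     (\<forall>v\<in>grid_nodes n. card {(\<phi> ^^ i) v | i. True} = p))"

text \<open>Centered square subgrid {d..n-1-d}^2 (d < n div 2, n even) and the minimum
  enclosing square: the smallest centered square containing all occupied nodes.\<close>
definition centered_square :: "nat \<Rightarrow> nat \<Rightarrow> node set" where
  "centered_square n d = {d..n - 1 - d} \<times> {d..n - 1 - d}"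

definition mes_offset :: "nat \<Rightarrow> config \<Rightarrow> nat" where
  "mes_offset n f = (GREATEST d. d < n div 2 \<and>
      (\<forall>v\<in>grid_nodes n. f v \<noteq> 0 \<longrightarrow> v \<in> centered_square n d))"

definition mes_corners :: "nat \<Rightarrow> config \<Rightarrow> node set" where
  "mes_corners n f = (let d = mes_offset n f in
     {(d, d), (d, n - 1 - d), (n - 1 - d, d), (n - 1 - d, n - 1 - d)})"

text \<open>Configuration induced by robot positions (robots 0..k-1), weak multiplicity detection.\<close>
definition config_of :: "nat \<Rightarrow> (nat \<Rightarrow> node) \<Rightarrow> config" where
  "config_of k pos v = (let m = card {r. r < k \<and> pos r = v} in
     if m = 0 then 0 else if m = 1 then 1 else 2)"

text \<open>View of a configuration through a local frame \<sigma> (local node u is global node \<sigma> u).\<close>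
definition view :: "nat \<Rightarrow> (node \<Rightarrow> node) \<Rightarrow> config \<Rightarrow> config" where
  "view n \<sigma> f = (\<lambda>u. if u \<in> grid_nodes n then f (\<sigma> u) else 0)"

text \<open>A deterministic algorithm maps (view, own position in the view) to a destination
  which is the own node or an adjacent node.\<close>
type_synonym algorithm = "config \<Rightarrow> node \<Rightarrow> node"

definition valid_alg :: "nat \<Rightarrow> algorithm \<Rightarrow> bool" where
  "valid_alg n A \<longleftrightarrow> (\<forall>g u. u \<in> grid_nodes n \<longrightarrow>
     A g u \<in> grid_nodes n \<and> (A g u = u \<or> grid_adj u (A g u)))"

definition non_crashed :: "(nat \<times> nat) option \<Rightarrow> nat \<Rightarrow> bool" where
  "non_crashed crash r = (case crash of None \<Rightarrow> True | Some (c, _) \<Rightarrow> r \<noteq> c)"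

text \<open>Fully asynchronous LCM execution, serialized into atomic events: at step t robot
  act t either performs a Look+Compute (if it has no pending move; the adversary chooses
  its local frame \<sigma>, an arbitrary grid automorphism) or its pending (instantaneous)
  Move. crash = Some (c, tc): robot c crashes at time tc and is never activated again
  (it stays visible). Every non-crashed robot is activated infinitely often.\<close>
definition lcm_execution :: "nat \<Rightarrow> algorithm \<Rightarrow> nat \<Rightarrow> config \<Rightarrow> (nat \<Rightarrow> nat \<Rightarrow> node)
    \<Rightarrow> (nat \<Rightarrow> nat \<Rightarrow> node option) \<Rightarrow> (nat \<Rightarrow> nat) \<Rightarrow> (nat \<times> nat) option \<Rightarrow> bool" where
  "lcm_execution n A k f0 pos pend act crash \<longleftrightarrow>
     inj_on (pos 0) {..<k} \<and> (\<forall>r<k. pos 0 r \<in> grid_nodes n) \<and>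
     config_of k (pos 0) = f0 \<and> (\<forall>r<k. pend 0 r = None) \<and>
     (\<forall>t. act t < k \<and>
        (case crash of None \<Rightarrow> True | Some (c, tc) \<Rightarrow> (tc \<le> t \<longrightarrow> act t \<noteq> c))) \<and>
     (\<forall>t. \<forall>r<k. r \<noteq> act t \<longrightarrow> pos (Suc t) r = pos t r \<and> pend (Suc t) r = pend t r) \<and>
     (\<forall>t. (case pend t (act t) of
            None \<Rightarrow> pos (Suc t) (act t) = pos t (act t) \<and>
                    (\<exists>\<sigma> u. grid_aut n \<sigma> \<and> u \<in> grid_nodes n \<and> \<sigma> u = pos t (act t) \<and>
                       pend (Suc t) (act t) = Some (\<sigma> (A (view n \<sigma> (config_of k (pos t))) u)))
          | Some w \<Rightarrow> pos (Suc t) (act t) = w \<and> pend (Suc t) (act t) = None)) \<and>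
     (\<forall>r<k. non_crashed crash r \<longrightarrow> (\<forall>T. \<exists>t\<ge>T. act t = r))"

definition gatherable_one_crash :: "nat \<Rightarrow> nat \<Rightarrow> config \<Rightarrow> bool" where
  "gatherable_one_crash n k f0 \<longleftrightarrow> (\<exists>A. valid_alg n A \<and>
     (\<forall>pos pend act crash. lcm_execution n A k f0 pos pend act crash \<longrightarrow>
        (\<exists>T v. \<forall>t\<ge>T. \<forall>r<k. non_crashed crash r \<longrightarrow> pos t r = v)))"

end

theory Submission
  imports Defs
begin

text \<open>Since $n$ is even, only reflections in a diagonal can be symmetries of a non-partitive
  configuration, and at most one of them is. Fix the diagonal of the enclosing square that is its
  axis (either one if there is none) and let the target be an end of it with the smaller sum of
  distances to the robots. The two other corner robots first step along the edges towards the
  target; at most one of them can be faulty. Once one has left, the diagonal is recognised as the one whose two ends are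
  both occupied, and the target by the now strictly smaller sum of distances. From then on the robot
  nearest to the target on each of its two edges advances, so again a correct robot is always
  enabled, and until the target is reached no node holds more than two robots, which makes the sum
  computable despite weak multiplicity detection. When a second robot reaches the target, the
  multiplicity marks it permanently and everybody walks there while avoiding the other corners.
  Every move, pending ones included, goes towards the same target, so the sum of distances to it
  never increases; when it stabilises, all correct robots must be at the target.\<close>

section \<open>Automorphisms of the grid\<close>

text \<open>The algorithm is chosen after the initial configuration, so it may carry
  \<open>f0\<close> as a template. Until a corner robot has left, a robot merely matches its view
  with \<open>f0\<close>; equal distance sums then need no tie-break, since every automorphism
  matching \<open>f0\<close> with itself fixes the target. The obstacle is asynchrony: a move may be
  executed in a later phase than the look that decided it. The invariant therefore constrains
  pending destinations as well as positions, and it keeps the other corners of the square free of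
  newcomers, so that a double count at a corner is always the target. Evenness of \<open>n\<close>
  means that no coordinate equals its mirror image. Hence axis reflections and rotations have no
  fixed node and are excluded by non-partitivity, which also excludes the two-by-two square, where a
  corner robot would reach the target in one step.\<close>

definition gdist :: "node \<Rightarrow> node \<Rightarrow> int" where
  "gdist u v = \<bar>int (fst u) - int (fst v)\<bar> + \<bar>int (snd u) - int (snd v)\<bar>"

lemma mem_grid [simp]: "(x, y) \<in> grid_nodes n \<longleftrightarrow> x < n \<and> y < n"
  by (auto simp: grid_nodes_def)

lemma gdist_step:
  assumes "u \<in> grid_nodes n" "v \<in> grid_nodes n" "u \<noteq> v"
  shows "\<exists>w\<in>grid_nodes n. grid_adj u w \<and> gdist w v = gdist u v - 1"
proof -
  obtain a b c d where uv: "u = (a, b)" "v = (c, d)" by (cases u, cases v)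
  consider "a < c" | "c < a" | "b < d" | "d < b" using assms uv by fastforce
  then show ?thesis
  proof cases
    case 1 then show ?thesis using assms uv
      by (intro bexI[of _ "(Suc a, b)"]) (auto simp: grid_adj_def gdist_def)
  next
    case 2 then show ?thesis using assms uv
      by (intro bexI[of _ "(a - 1, b)"]) (auto simp: grid_adj_def gdist_def)
  next
    case 3 then show ?thesis using assms uv
      by (intro bexI[of _ "(a, Suc b)"]) (auto simp: grid_adj_def gdist_def)
  next
    case 4 then show ?thesis using assms uv
      by (intro bexI[of _ "(a, b - 1)"]) (auto simp: grid_adj_def gdist_def)
  qed
qed

lemma gdist_triangle: "gdist u w \<le> gdist u v + gdist v w"
  by (simp add: gdist_def)

lemma grid_adj_gdist: "grid_adj u v \<longleftrightarrow> gdist u v = 1"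
  by (simp add: grid_adj_def gdist_def)

lemma grid_aut_mem: "grid_aut n \<phi> \<Longrightarrow> v \<in> grid_nodes n \<Longrightarrow> \<phi> v \<in> grid_nodes n"
  by (auto simp: grid_aut_def bij_betw_def)

lemma grid_aut_adj:
  "grid_aut n \<phi> \<Longrightarrow> u \<in> grid_nodes n \<Longrightarrow> v \<in> grid_nodes n \<Longrightarrow>
    grid_adj (\<phi> u) (\<phi> v) \<longleftrightarrow> grid_adj u v"
  by (simp add: grid_aut_def)

lemma grid_aut_inv_left:
  "grid_aut n \<phi> \<Longrightarrow> v \<in> grid_nodes n \<Longrightarrow> inv_into (grid_nodes n) \<phi> (\<phi> v) = v"
  by (simp add: grid_aut_def bij_betw_def)

lemma grid_aut_inv_right:
  "grid_aut n \<phi> \<Longrightarrow> v \<in> grid_nodes n \<Longrightarrow> \<phi> (inv_into (grid_nodes n) \<phi> v) = v"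
  by (simp add: grid_aut_def bij_betw_def f_inv_into_f)

lemma grid_aut_inv:
  assumes "grid_aut n \<phi>"
  shows "grid_aut n (inv_into (grid_nodes n) \<phi>)"
proof -
  let ?i = "inv_into (grid_nodes n) \<phi>"
  have b: "bij_betw ?i (grid_nodes n) (grid_nodes n)"
    using assms by (simp add: grid_aut_def bij_betw_inv_into)
  have "grid_adj (?i u) (?i v) \<longleftrightarrow> grid_adj u v" if "u \<in> grid_nodes n" "v \<in> grid_nodes n" for u v
  proof -
    have "?i u \<in> grid_nodes n" "?i v \<in> grid_nodes n" using b that by (auto simp: bij_betw_def)
    then show ?thesis
      using grid_aut_adj[OF assms] grid_aut_inv_right[OF assms] that by metis
  qed
  with b show ?thesis by (auto simp: grid_aut_def)
qed

lemma grid_aut_comp: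
  assumes "grid_aut n \<phi>" "grid_aut n \<psi>"
  shows "grid_aut n (\<phi> \<circ> \<psi>)"
  using assms grid_aut_mem[OF assms(2)]
  by (auto simp: grid_aut_def intro: bij_betw_trans)

text \<open>Induction along a shortest path, whose edges are mapped to edges. Applied to the inverse
  as well, this makes every automorphism an isometry.\<close>

lemma grid_aut_contract:
  assumes "grid_aut n \<phi>"
  shows "u \<in> grid_nodes n \<Longrightarrow> v \<in> grid_nodes n \<Longrightarrow> gdist (\<phi> u) (\<phi> v) \<le> gdist u v"
proof (induction "nat (gdist u v)" arbitrary: u)
  case 0
  then have "u = v" by (auto simp: gdist_def intro: prod_eqI)
  then show ?case by (simp add: gdist_def)
next
  case (Suc m)
  then have "u \<noteq> v" by (auto simp: gdist_def)
  then obtain w where w: "w \<in> grid_nodes n" "grid_adj u w" "gdist w v = gdist u v - 1"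
    using gdist_step Suc.prems by blast
  have "gdist (\<phi> w) (\<phi> v) \<le> gdist w v"
    using Suc w by (intro Suc.hyps(1)) auto
  moreover have "gdist (\<phi> u) (\<phi> w) = 1"
    using grid_aut_adj[OF assms Suc.prems(1) w(1)] w(2) by (simp add: grid_adj_gdist)
  ultimately show ?case using gdist_triangle[of "\<phi> u" "\<phi> v" "\<phi> w"] w(3) by simp
qed

lemma grid_aut_gdist:
  assumes "grid_aut n \<phi>" "u \<in> grid_nodes n" "v \<in> grid_nodes n"
  shows "gdist (\<phi> u) (\<phi> v) = gdist u v"
  using grid_aut_contract[OF assms]
    grid_aut_contract[OF grid_aut_inv[OF assms(1)], of "\<phi> u" "\<phi> v"]
    grid_aut_mem[OF assms(1)] grid_aut_inv_left[OF assms(1)] assms(2,3)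
  by (metis antisym)

text \<open>The dihedral group of the square: \<open>s\<close> transposes first, then
  \<open>a\<close> and \<open>b\<close> reflect the coordinates of the result.\<close>

definition sym_map :: "nat \<Rightarrow> bool \<Rightarrow> bool \<Rightarrow> bool \<Rightarrow> node \<Rightarrow> node" where
  "sym_map n s a b v = (let x = if s then snd v else fst v; y = if s then fst v else snd v in
     (if a then n - 1 - x else x, if b then n - 1 - y else y))"

text \<open>\<open>(o1, o2)\<close> and \<open>(e1, e2)\<close> are the images of the adjacent
  corners \<open>(0, 0)\<close> and \<open>(M, 0)\<close>, and \<open>(x', y')\<close> is the image
  of \<open>(x, y)\<close>. For nonzero \<open>M\<close> the two images differ in exactly one
  coordinate, which decides whether the map transposes; the distances then form a linear system.
  Integers avoid truncated subtraction.\<close>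

lemma corner_coordinates:
  fixes M x y x' y' o1 o2 e1 e2 :: int
  assumes "o1 = 0 \<or> o1 = M" "o2 = 0 \<or> o2 = M" "e1 = 0 \<or> e1 = M" "e2 = 0 \<or> e2 = M"
    and "\<bar>o1 - e1\<bar> + \<bar>o2 - e2\<bar> = M"
    and "\<bar>x' - o1\<bar> + \<bar>y' - o2\<bar> = x + y" "\<bar>x' - e1\<bar> + \<bar>y' - e2\<bar> = M - x + y"
    and "0 \<le> x'" "0 \<le> y'" "0 \<le> x" "0 \<le> y" "x \<le> M" "y \<le> M" "x' \<le> M" "y' \<le> M"
  shows "x' = (if o1 \<noteq> 0 then M - (if e1 = o1 then y else x) else (if e1 = o1 then y else x))"
    and "y' = (if o2 \<noteq> 0 then M - (if e1 = o1 then x else y) else (if e1 = o1 then x else y))"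
proof -
  have "(x' = (if o1 \<noteq> 0 then M - (if e1 = o1 then y else x) else (if e1 = o1 then y else x))) \<and>
      (y' = (if o2 \<noteq> 0 then M - (if e1 = o1 then x else y) else (if e1 = o1 then x else y)))"
  proof (cases "M = 0")
    case True then show ?thesis using assms by simp
  next
    case False
    have "(e1 = o1 \<and> e2 = M - o2) \<or> (e1 = M - o1 \<and> e2 = o2)"
      using assms(1-5,10,12) False by (elim disjE) simp_all
    then show ?thesis
      using assms(1,2) 
      by (elim disjE conjE) (use False assms(6-) in \<open>simp_all add: abs_if split: if_splits\<close>)
  qed
  then show "x' = (if o1 \<noteq> 0 then M - (if e1 = o1 then y else x) else (if e1 = o1 then y else x))"
    "y' = (if o2 \<noteq> 0 then M - (if e1 = o1 then x else y) else (if e1 = o1 then x else y))"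
    by blast+
qed

text \<open>Opposite corners are the pairs at maximal distance, and a node is determined by its
  distances to two adjacent corners.\<close>

lemma grid_aut_sym_map:
  assumes "grid_aut n \<phi>"
  obtains s a b where "\<And>v. v \<in> grid_nodes n \<Longrightarrow> \<phi> v = sym_map n s a b v"
proof (cases "n = 0")
  case True
  then show ?thesis using that by (auto simp: grid_nodes_def)
next
  case False
  let ?N = "n - 1"
  have d: "gdist (\<phi> u) (\<phi> v) = gdist u v" if "u \<in> grid_nodes n" "v \<in> grid_nodes n" for u v
    using grid_aut_gdist[OF assms that] .
  obtain o1 o2 where o: "\<phi> (0, 0) = (o1, o2)" by fastforce
  obtain p1 p2 where p: "\<phi> (?N, ?N) = (p1, p2)" by fastforce
  obtain e1 e2 where e: "\<phi> (?N, 0) = (e1, e2)" by fastforce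
  obtain q1 q2 where q: "\<phi> (0, ?N) = (q1, q2)" by fastforce
  have le: "o1 \<le> ?N" "o2 \<le> ?N" "p1 \<le> ?N" "p2 \<le> ?N" "e1 \<le> ?N" "e2 \<le> ?N" "q1 \<le> ?N" "q2 \<le> ?N"
    using grid_aut_mem[OF assms, of "(0, 0)"] grid_aut_mem[OF assms, of "(?N, ?N)"]
      grid_aut_mem[OF assms, of "(?N, 0)"] grid_aut_mem[OF assms, of "(0, ?N)"] False o p e q
    by auto
  have op: "\<bar>int o1 - int p1\<bar> + \<bar>int o2 - int p2\<bar> = 2 * int ?N"
    using d[of "(0, 0)" "(?N, ?N)"] False o p by (simp add: gdist_def)
  have eq: "\<bar>int e1 - int q1\<bar> + \<bar>int e2 - int q2\<bar> = 2 * int ?N"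
    using d[of "(?N, 0)" "(0, ?N)"] False e q by (simp add: gdist_def)
  have oe: "\<bar>int o1 - int e1\<bar> + \<bar>int o2 - int e2\<bar> = int ?N"
    using d[of "(0, 0)" "(?N, 0)"] False e o by (simp add: gdist_def)
  have oc: "(o1 = 0 \<or> o1 = ?N) \<and> (o2 = 0 \<or> o2 = ?N)" using op le by linarith
  have ec: "(e1 = 0 \<or> e1 = ?N) \<and> (e2 = 0 \<or> e2 = ?N)" using eq le by linarith
  have "\<phi> v = sym_map n (e1 = o1) (o1 \<noteq> 0) (o2 \<noteq> 0) v" if v: "v \<in> grid_nodes n" for v
  proof -
    obtain x y where xy: "v = (x, y)" by fastforce
    obtain x' y' where xy': "\<phi> v = (x', y')" by fastforce
    have l: "x \<le> ?N" "y \<le> ?N" "x' \<le> ?N" "y' \<le> ?N"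
      using v grid_aut_mem[OF assms v] xy xy' by auto
    have 1: "\<bar>int x' - int o1\<bar> + \<bar>int y' - int o2\<bar> = int x + int y"
      using d[of v "(0, 0)"] v False xy xy' o by (simp add: gdist_def)
    have 2: "\<bar>int x' - int e1\<bar> + \<bar>int y' - int e2\<bar> = int ?N - int x + int y"
      using d[of v "(?N, 0)"] v False xy xy' e l by (simp add: gdist_def)
    have ends: "int o1 = 0 \<or> int o1 = int ?N" "int o2 = 0 \<or> int o2 = int ?N"
      "int e1 = 0 \<or> int e1 = int ?N" "int e2 = 0 \<or> int e2 = int ?N"
      using oc ec by auto
    have bounds: "0 \<le> int x'" "0 \<le> int y'" "0 \<le> int x" "0 \<le> int y" "int x \<le> int ?N"
      "int y \<le> int ?N" "int x' \<le> int ?N" "int y' \<le> int ?N"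
      using l by simp_all
    note c = corner_coordinates[OF ends oe 1 2 bounds]
    have x': "int x' = (if int o1 \<noteq> 0 then int ?N - (if int e1 = int o1 then int y else int x)
        else (if int e1 = int o1 then int y else int x))"
      by (rule c(1))
    have y': "int y' = (if int o2 \<noteq> 0 then int ?N - (if int e1 = int o1 then int x else int y)
        else (if int e1 = int o1 then int x else int y))"
      by (rule c(2))
    have "x' = (if o1 \<noteq> 0 then ?N - (if e1 = o1 then y else x) else (if e1 = o1 then y else x))"
      using x' l by (cases "o1 = 0"; cases "e1 = o1") simp_all
    moreover have "y' = (if o2 \<noteq> 0 then ?N - (if e1 = o1 then x else y) else (if e1 = o1 then x else y))"
      using y' l by (cases "o2 = 0"; cases "e1 = o1") simp_all
    ultimately show ?thesis
      unfolding xy' unfolding xy sym_map_def Let_def by (simp only: fst_conv snd_conv not_False_eq_True)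
  qed
  then show ?thesis using that by blast
qed

lemma sym_map_grid_aut: "grid_aut n (sym_map n s a b)"
proof -
  let ?\<phi> = "sym_map n s a b"
  \<comment> \<open>Moving the transposition past the reflections exchanges their roles, so the
    inverse swaps \<open>a\<close> and \<open>b\<close> exactly when \<open>s\<close> holds.\<close>
  let ?\<psi> = "sym_map n s (if s then b else a) (if s then a else b)"
  have "bij_betw ?\<phi> (grid_nodes n) (grid_nodes n)"
    by (rule bij_betw_byWitness[where f' = ?\<psi>]) (auto simp: sym_map_def grid_nodes_def Let_def)
  moreover have "grid_adj (?\<phi> u) (?\<phi> v) \<longleftrightarrow> grid_adj u v"
    if "u \<in> grid_nodes n" "v \<in> grid_nodes n" for u v
    using that by (cases u; cases v) (auto simp: sym_map_def grid_adj_def of_nat_diff Let_def)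
  ultimately show ?thesis by (simp add: grid_aut_def)
qed

section \<open>Criteria for partitivity\<close>

lemma partitive_of_order2:
  assumes "grid_aut n \<phi>" "\<And>v. v \<in> grid_nodes n \<Longrightarrow> f (\<phi> v) = f v" "n > 0"
    and "\<And>v. v \<in> grid_nodes n \<Longrightarrow> \<phi> (\<phi> v) = v" "\<And>v. v \<in> grid_nodes n \<Longrightarrow> \<phi> v \<noteq> v"
  shows "partitive n f"
proof -
  have orb: "{(\<phi> ^^ i) v | i. True} = {v, \<phi> v}" if v: "v \<in> grid_nodes n" for v
  proof -
    have "(\<phi> ^^ i) v \<in> {v, \<phi> v}" for i by (induction i) (use assms(4)[OF v] in auto)
    moreover have "(\<phi> ^^ 0) v = v" "(\<phi> ^^ 1) v = \<phi> v" by simp_all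
    ultimately show ?thesis by (smt (verit, best) Collect_cong insert_compr singletonD insertE)
  qed
  have 0: "(0, 0) \<in> grid_nodes n" using assms(3) by simp
  have "\<exists>v\<in>grid_nodes n. (\<phi> ^^ q) v \<noteq> v" if "0 < q" "q < 2" for q :: nat
  proof -
    have "q = 1" using that by simp
    then show ?thesis using assms(5)[OF 0] 0 by (auto intro!: bexI[of _ "(0, 0)"])
  qed
  moreover have "card {(\<phi> ^^ i) v | i. True} = 2" if v: "v \<in> grid_nodes n" for v
    using orb[OF v] assms(5)[OF v] by simp
  moreover have "(\<phi> ^^ 2) v = v" if "v \<in> grid_nodes n" for v
    using assms(4)[OF that] by (simp add: eval_nat_numeral)
  ultimately show ?thesis unfolding partitive_def
    using assms(1,2) by (intro exI[of _ \<phi>] exI[of _ 2]) auto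
qed

text \<open>An orbit of size one or two would be fixed pointwise by the square of the map, so a
  square without fixed nodes forces all orbits to have size four.\<close>

lemma partitive_of_order4:
  assumes "grid_aut n \<phi>" "\<And>v. v \<in> grid_nodes n \<Longrightarrow> f (\<phi> v) = f v" "n > 0"
    and "\<And>v. v \<in> grid_nodes n \<Longrightarrow> \<phi> (\<phi> (\<phi> (\<phi> v))) = v"
    and "\<And>v. v \<in> grid_nodes n \<Longrightarrow> \<phi> (\<phi> v) \<noteq> v"
  shows "partitive n f"
proof -
  have dist: "distinct [v, \<phi> v, \<phi> (\<phi> v), \<phi> (\<phi> (\<phi> v))]" if v: "v \<in> grid_nodes n" for v
    using assms(4,5)[OF v] assms(4,5)[OF grid_aut_mem[OF assms(1) v]] by (simp; metis)
  have orb: "{(\<phi> ^^ i) v | i. True} = set [v, \<phi> v, \<phi> (\<phi> v), \<phi> (\<phi> (\<phi> v))]"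
    if v: "v \<in> grid_nodes n" for v
  proof -
    have "(\<phi> ^^ i) v \<in> set [v, \<phi> v, \<phi> (\<phi> v), \<phi> (\<phi> (\<phi> v))]" for i
      by (induction i) (use assms(4)[OF v] in auto)
    moreover have "(\<phi> ^^ 0) v = v" "(\<phi> ^^ 1) v = \<phi> v" "(\<phi> ^^ 2) v = \<phi> (\<phi> v)"
      "(\<phi> ^^ 3) v = \<phi> (\<phi> (\<phi> v))" by (simp_all add: eval_nat_numeral)
    ultimately show ?thesis by (auto; metis)
  qed
  have card: "card {(\<phi> ^^ i) v | i. True} = 4" if "v \<in> grid_nodes n" for v
    using distinct_card[OF dist[OF that]] orb[OF that] by simp
  have 0: "(0, 0) \<in> grid_nodes n" using assms(3) by simp
  have "\<exists>v\<in>grid_nodes n. (\<phi> ^^ q) v \<noteq> v" if "0 < q" "q < 4" for q :: nat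
  proof -
    have "q = 1 \<or> q = 2 \<or> q = 3" using that by arith
    then consider "q = 1" | "q = 2" | "q = 3" by blast
    then show ?thesis
      by cases (use dist[OF 0] 0 in \<open>auto simp: eval_nat_numeral intro!: bexI[of _ "(0, 0)"]\<close>)
  qed
  moreover have "(\<phi> ^^ 4) v = v" if "v \<in> grid_nodes n" for v
    using assms(4)[OF that] by (simp add: eval_nat_numeral)
  ultimately show ?thesis unfolding partitive_def
    using assms(1,2) card by (intro exI[of _ \<phi>] exI[of _ 4]) auto
qed

section \<open>Relabelling executions\<close>

lemma lcm_executionD:
  assumes "lcm_execution n A k f0 pos pend act crash"
  shows "inj_on (pos 0) {..<k}" "\<And>r. r < k \<Longrightarrow> pos 0 r \<in> grid_nodes n" "config_of k (pos 0) = f0"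
    "\<And>r. r < k \<Longrightarrow> pend 0 r = None" "\<And>t. act t < k"
    "\<And>t. case crash of None \<Rightarrow> True | Some (c, tc) \<Rightarrow> (tc \<le> t \<longrightarrow> act t \<noteq> c)"
    "\<And>t r. r < k \<Longrightarrow> r \<noteq> act t \<Longrightarrow> pos (Suc t) r = pos t r"
    "\<And>t r. r < k \<Longrightarrow> r \<noteq> act t \<Longrightarrow> pend (Suc t) r = pend t r"
    "\<And>t. pend t (act t) = None \<Longrightarrow> pos (Suc t) (act t) = pos t (act t)"
    "\<And>t. pend t (act t) = None \<Longrightarrow> \<exists>\<sigma> u. grid_aut n \<sigma> \<and> u \<in> grid_nodes n \<and> \<sigma> u = pos t (act t) \<and>
       pend (Suc t) (act t) = Some (\<sigma> (A (view n \<sigma> (config_of k (pos t))) u))"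
    "\<And>t w. pend t (act t) = Some w \<Longrightarrow> pos (Suc t) (act t) = w"
    "\<And>t w. pend t (act t) = Some w \<Longrightarrow> pend (Suc t) (act t) = None"
    "\<And>r T. r < k \<Longrightarrow> non_crashed crash r \<Longrightarrow> \<exists>t\<ge>T. act t = r"
proof -
  note D = assms[unfolded lcm_execution_def]
  have ev: "case pend t (act t) of
            None \<Rightarrow> pos (Suc t) (act t) = pos t (act t) \<and>
                    (\<exists>\<sigma> u. grid_aut n \<sigma> \<and> u \<in> grid_nodes n \<and> \<sigma> u = pos t (act t) \<and>
                       pend (Suc t) (act t) = Some (\<sigma> (A (view n \<sigma> (config_of k (pos t))) u)))
          | Some w \<Rightarrow> pos (Suc t) (act t) = w \<and> pend (Suc t) (act t) = None" for t
    using D by blast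
  show "\<And>t. pend t (act t) = None \<Longrightarrow> pos (Suc t) (act t) = pos t (act t)"
    subgoal for t using ev[of t] by simp done
  show "\<And>t. pend t (act t) = None \<Longrightarrow> \<exists>\<sigma> u. grid_aut n \<sigma> \<and> u \<in> grid_nodes n \<and> \<sigma> u = pos t (act t) \<and>
       pend (Suc t) (act t) = Some (\<sigma> (A (view n \<sigma> (config_of k (pos t))) u))"
    subgoal for t using ev[of t] by simp done
  show "\<And>t w. pend t (act t) = Some w \<Longrightarrow> pos (Suc t) (act t) = w"
    subgoal for t using ev[of t] by simp done
  show "\<And>t w. pend t (act t) = Some w \<Longrightarrow> pend (Suc t) (act t) = None"
    subgoal for t using ev[of t] by simp done
qed (use assms[unfolded lcm_execution_def] in blast)+

lemma execution_in_grid: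
  assumes A: "valid_alg n A" and ex: "lcm_execution n A k f0 pos pend act crash" and r: "r < k"
  shows "pos t r \<in> grid_nodes n \<and> (\<forall>w. pend t r = Some w \<longrightarrow> w \<in> grid_nodes n)"
  using r
proof (induction t arbitrary: r)
  case 0
  then show ?case using lcm_executionD(2,4)[OF ex] by simp
next
  case (Suc t)
  show ?case
  proof (cases "r = act t")
    case False
    then show ?thesis using Suc lcm_executionD(7,8)[OF ex, of r t] by simp
  next
    case True
    show ?thesis
    proof (cases "pend t r")
      case None
      then obtain \<sigma> u where "grid_aut n \<sigma>" "u \<in> grid_nodes n"
        "pend (Suc t) r = Some (\<sigma> (A (view n \<sigma> (config_of k (pos t))) u))"
        using lcm_executionD(10)[OF ex, of t] True by auto
      moreover from this A have "A (view n \<sigma> (config_of k (pos t))) u \<in> grid_nodes n"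
        unfolding valid_alg_def by blast
      ultimately show ?thesis
        using lcm_executionD(9)[OF ex, of t] True None Suc grid_aut_mem by auto
    next
      case (Some w)
      then show ?thesis using lcm_executionD(11,12)[OF ex, of t] True Suc by (cases w) auto
    qed
  qed
qed

lemma view_view:
  assumes "grid_aut n \<psi>"
  shows "view n \<psi> (view n \<sigma> f) = view n (\<sigma> \<circ> \<psi>) f"
  using grid_aut_mem[OF assms] by (auto simp: view_def)

lemma view_config_of:
  assumes "grid_aut n \<tau>" "\<And>v. v \<in> grid_nodes n \<Longrightarrow> \<tau> (\<tau> v) = v"
    and "\<And>r. r < k \<Longrightarrow> pos r \<in> grid_nodes n"
  shows "config_of k (\<lambda>r. \<tau> (pos r)) = view n \<tau> (config_of k pos)"
proof
  fix v
  show "config_of k (\<lambda>r. \<tau> (pos r)) v = view n \<tau> (config_of k pos) v"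
  proof (cases "v \<in> grid_nodes n")
    case True
    then have "{r. r < k \<and> \<tau> (pos r) = v} = {r. r < k \<and> pos r = \<tau> v}"
      using assms by metis
    then show ?thesis using True by (simp add: view_def config_of_def)
  next
    case False
    then have "{r. r < k \<and> \<tau> (pos r) = v} = {}"
      using assms grid_aut_mem by blast
    then show ?thesis using False by (simp add: view_def config_of_def)
  qed
qed

text \<open>The adversary may use any automorphism as a local frame. Replacing each frame
  \<open>\<sigma>\<close> by \<open>\<tau> \<circ> \<sigma>\<close> compensates the relabelling in
  every view, so the relabelled execution is again an execution of the same algorithm.\<close>

lemma gatherable_relabel:
  assumes \<tau>: "grid_aut n \<tau>" and inv: "\<And>v. v \<in> grid_nodes n \<Longrightarrow> \<tau> (\<tau> v) = v"
    and g: "gatherable_one_crash n k (view n \<tau> f0)"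
  shows "gatherable_one_crash n k f0"
proof -
  obtain A where A: "valid_alg n A" and gA: "\<And>pos pend act crash.
      lcm_execution n A k (view n \<tau> f0) pos pend act crash \<Longrightarrow>
      \<exists>T v. \<forall>t\<ge>T. \<forall>r<k. non_crashed crash r \<longrightarrow> pos t r = v"
    using g unfolding gatherable_one_crash_def by blast
  have "\<exists>T v. \<forall>t\<ge>T. \<forall>r<k. non_crashed crash r \<longrightarrow> pos t r = v"
    if ex: "lcm_execution n A k f0 pos pend act crash" for pos pend act crash
  proof -
    note E = lcm_executionD[OF ex]
    have G: "pos t r \<in> grid_nodes n" "pend t r = Some w \<Longrightarrow> w \<in> grid_nodes n" if "r < k" for t r w
      using execution_in_grid[OF A ex that] by blast+
    let ?pos = "\<lambda>t r. \<tau> (pos t r)"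
    let ?pend = "\<lambda>t r. map_option \<tau> (pend t r)"
    have cfg: "config_of k (?pos t) = view n \<tau> (config_of k (pos t))" for t
      using view_config_of[OF \<tau> inv] G by blast
    have inj: "inj_on (?pos 0) {..<k}"
      using E(1) G(1) inv unfolding inj_on_def by (metis lessThan_iff)
    have look: "\<exists>\<sigma> u. grid_aut n \<sigma> \<and> u \<in> grid_nodes n \<and> \<sigma> u = ?pos t (act t) \<and>
       ?pend (Suc t) (act t) = Some (\<sigma> (A (view n \<sigma> (config_of k (?pos t))) u))"
      if pn: "pend t (act t) = None" for t
    proof -
      obtain \<sigma> u where \<sigma>: "grid_aut n \<sigma>" "u \<in> grid_nodes n" "\<sigma> u = pos t (act t)"
       "pend (Suc t) (act t) = Some (\<sigma> (A (view n \<sigma> (config_of k (pos t))) u))"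
        using E(10)[OF pn] by blast
      have "view n (\<tau> \<circ> \<sigma>) (config_of k (?pos t)) = view n \<sigma> (config_of k (pos t))"
      proof -
        have "view n \<sigma> (view n \<tau> (view n \<tau> (config_of k (pos t)))) = view n \<sigma> (config_of k (pos t))"
          by (rule ext) (simp add: view_def inv grid_aut_mem[OF \<tau>] grid_aut_mem[OF \<sigma>(1)])
        then show ?thesis unfolding cfg
          by (simp add: view_view[OF \<sigma>(1)])
      qed
      then show ?thesis
        using \<sigma> grid_aut_comp[OF \<tau> \<sigma>(1)]
        by (intro exI[of _ "\<tau> \<circ> \<sigma>"] exI[of _ u]) simp
    qed
    have "lcm_execution n A k (view n \<tau> f0) ?pos ?pend act crash"
      unfolding lcm_execution_def
    proof (intro conjI allI impI)
      show "inj_on (?pos 0) {..<k}" by (fact inj)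
      show "?pos 0 r \<in> grid_nodes n" if "r < k" for r using G(1)[OF that] grid_aut_mem[OF \<tau>] by blast
      show "config_of k (?pos 0) = view n \<tau> f0" using cfg E(3) by simp
      show "?pend 0 r = None" if "r < k" for r using E(4)[OF that] by simp
      show "act t < k" for t by (rule E(5))
      show "case crash of None \<Rightarrow> True | Some (c, tc) \<Rightarrow> tc \<le> t \<longrightarrow> act t \<noteq> c" for t
        by (rule E(6))
      show "?pos (Suc t) r = ?pos t r" if "r < k" "r \<noteq> act t" for t r using E(7)[OF that] by simp
      show "?pend (Suc t) r = ?pend t r" if "r < k" "r \<noteq> act t" for t r using E(8)[OF that] by simp
      show "case ?pend t (act t) of
          None \<Rightarrow> ?pos (Suc t) (act t) = ?pos t (act t) \<and>
            (\<exists>\<sigma> u. grid_aut n \<sigma> \<and> u \<in> grid_nodes n \<and> \<sigma> u = ?pos t (act t) \<and>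
              ?pend (Suc t) (act t) = Some (\<sigma> (A (view n \<sigma> (config_of k (?pos t))) u)))
        | Some w \<Rightarrow> ?pos (Suc t) (act t) = w \<and> ?pend (Suc t) (act t) = None" for t
      proof (cases "pend t (act t)")
        case None
        then show ?thesis using look[OF None] E(9)[OF None] by simp
      next
        case (Some w)
        then show ?thesis using E(11)[OF Some] E(12)[OF Some] by simp
      qed
      show "\<exists>t\<ge>T. act t = r" if "r < k" "non_crashed crash r" for r T by (rule E(13)[OF that])
    qed
    from gA[OF this] obtain T v where
      *: "\<And>t r. t \<ge> T \<Longrightarrow> r < k \<Longrightarrow> non_crashed crash r \<Longrightarrow> \<tau> (pos t r) = v" by blast
    have "\<forall>t\<ge>T. \<forall>r<k. non_crashed crash r \<longrightarrow> pos t r = \<tau> v"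
      using * G(1) inv by metis
    then show ?thesis by blast
  qed
  with A show ?thesis unfolding gatherable_one_crash_def by blast
qed

section \<open>The algorithm\<close>

definition coord_sum :: "node \<Rightarrow> nat" where
  "coord_sum v = fst v + snd v"

definition total_count :: "nat \<Rightarrow> config \<Rightarrow> nat" where
  "total_count n f = (\<Sum>v\<in>grid_nodes n. f v)"

text \<open>For configurations inside the square \<open>{lo..}\<close> this is the sum of distances
  to \<open>(lo, lo)\<close> up to a constant per counted robot.\<close>

definition weight :: "nat \<Rightarrow> config \<Rightarrow> nat" where
  "weight n f = (\<Sum>v\<in>grid_nodes n. f v * coord_sum v)"

lemma total_count_view:
  assumes "grid_aut n \<psi>"
  shows "total_count n (view n \<psi> f) = total_count n f"
proof -
  have "bij_betw \<psi> (grid_nodes n) (grid_nodes n)" using assms by (simp add: grid_aut_def)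
  from sum.reindex_bij_betw[OF this, of f] show ?thesis by (simp add: total_count_def view_def)
qed

text \<open>The half-turn and the reflection in the antidiagonal replace each coordinate sum by its
  complement to \<open>2 * (n - 1)\<close>. So the weight cannot lie strictly below the mean in both
  views, which is how \<open>departed\<close> tells the two ends of the diagonal apart.\<close>

lemma weight_view_antipodal:
  assumes "grid_aut n \<psi>"
    and anti: "\<And>v. v \<in> grid_nodes n \<Longrightarrow> coord_sum (\<psi> v) + coord_sum v = 2 * (n - 1)"
  shows "weight n (view n \<psi> f) + weight n f = 2 * (n - 1) * total_count n f"
proof -
  have b: "bij_betw \<psi> (grid_nodes n) (grid_nodes n)" using assms by (simp add: grid_aut_def)
  have "weight n (view n \<psi> f) + weight n f
      = (\<Sum>v\<in>grid_nodes n. f (\<psi> v) * coord_sum v) + (\<Sum>v\<in>grid_nodes n. f (\<psi> v) * coord_sum (\<psi> v))"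
    using sum.reindex_bij_betw[OF b, of "\<lambda>v. f v * coord_sum v"]
    by (simp add: weight_def view_def)
  also have "\<dots> = (\<Sum>v\<in>grid_nodes n. f (\<psi> v) * (2 * (n - 1)))"
    unfolding sum.distrib[symmetric]
    by (rule sum.cong) (simp_all only: anti[symmetric] distrib_left add.commute)
  also have "\<dots> = (\<Sum>v\<in>grid_nodes n. f (\<psi> v)) * (2 * (n - 1))"
    by (simp only: sum_distrib_right)
  also have "\<dots> = 2 * (n - 1) * total_count n f"
    using sum.reindex_bij_betw[OF b, of f] by (simp add: total_count_def)
  finally show ?thesis .
qed

section \<open>Normal form, recognition of the target and the decision rule\<close>

definition descends :: "node \<Rightarrow> node \<Rightarrow> bool" where
  "descends w w' \<longleftrightarrow> (Suc (fst w') = fst w \<and> snd w' = snd w) \<or> (fst w' = fst w \<and> Suc (snd w') = snd w)"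

text \<open>The target is \<open>(lo, lo)\<close>; \<open>balance\<close> makes it an end with no
  larger distance sum than the opposite one, and \<open>stab\<close> is what remains of
  non-partitivity. By \<open>size\<close> the square is at least three nodes wide: a corner robot
  does not reach the target in one step, and a step off the diagonal does not hit a corner.\<close>

locale normal_form =
  fixes n lo :: nat and f0 :: config
  assumes size: "2 * lo + 3 \<le> n"
    and supp: "\<And>v. f0 v \<noteq> 0 \<Longrightarrow> v \<in> centered_square n lo"
    and corners: "f0 (lo, lo) = 1" "f0 (n - 1 - lo, lo) = 1" "f0 (lo, n - 1 - lo) = 1"
      "f0 (n - 1 - lo, n - 1 - lo) = 1"
    and balance: "weight n f0 \<le> (n - 1) * total_count n f0"
    and stab: "\<And>\<psi>. grid_aut n \<psi> \<Longrightarrow> (\<And>v. v \<in> grid_nodes n \<Longrightarrow> f0 (\<psi> v) = f0 v) \<Longrightarrow>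
      \<psi> (lo, lo) = (lo, lo)"
begin

definition hi :: nat where "hi = n - 1 - lo"

lemma hi: "lo + 2 \<le> hi" "hi < n" "lo < n" "n - 1 - lo = hi" "n - 1 - hi = lo" "lo + hi = n - 1"
  using size by (auto simp: hi_def)

definition departed :: "config \<Rightarrow> bool" where
  "departed f \<longleftrightarrow> f (lo, lo) = 1 \<and> f (hi, hi) = 1 \<and> f (hi, lo) \<le> 1 \<and> f (lo, hi) \<le> 1 \<and>
     (f (hi, lo) = 0 \<or> f (lo, hi) = 0) \<and> weight n f < (n - 1) * total_count n f"

definition piled :: "config \<Rightarrow> bool" where
  "piled f \<longleftrightarrow> f (lo, lo) = 2 \<and> f (hi, hi) \<le> 1 \<and> f (hi, lo) \<le> 1 \<and> f (lo, hi) \<le> 1"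

definition good :: "config \<Rightarrow> bool" where
  "good f \<longleftrightarrow> f = f0 \<or> departed f \<or> piled f"

lemma corner_preimage:
  assumes "v \<in> {lo, hi} \<times> {lo, hi}"
  shows "\<exists>u\<in>{lo, hi} \<times> {lo, hi}. sym_map n s a b u = v"
proof -
  have "v \<in> {(lo, lo), (lo, hi), (hi, lo), (hi, hi)}" using assms by auto
  moreover have "sym_map n s a b ` {(lo, lo), (lo, hi), (hi, lo), (hi, hi)} = {(lo, lo), (lo, hi), (hi, lo), (hi, hi)}"
    using hi(4,5) by (cases s; cases a; cases b) (auto simp: sym_map_def)
  ultimately have "v \<in> sym_map n s a b ` {(lo, lo), (lo, hi), (hi, lo), (hi, hi)}" by simp
  then show ?thesis by auto
qed

text \<open>The phase can be read off the corner values, which automorphisms permute: all are one in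
  \<open>f0\<close>, some is zero and none is two after a departure, one is two once piled. The
  target is then fixed by \<open>stab\<close>, by the occupied diagonal together with the strict
  weight inequality, or by the unique double count.\<close>

lemma good_target:
  assumes \<psi>: "grid_aut n \<psi>" and g: "good f" "good (view n \<psi> f)"
  shows "\<psi> (lo, lo) = (lo, lo)"
proof -
  obtain s a b where s: "\<And>v. v \<in> grid_nodes n \<Longrightarrow> \<psi> v = sym_map n s a b v"
    using grid_aut_sym_map[OF \<psi>] by metis
  let ?f = "view n \<psi> f"
  have c: "?f (lo, lo) = f (if a then hi else lo, if b then hi else lo)"
    "?f (hi, hi) = f (if a then lo else hi, if b then lo else hi)"
    "?f (hi, lo) = f (sym_map n s a b (hi, lo))" "?f (lo, hi) = f (sym_map n s a b (lo, hi))"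
    using hi by (simp_all add: view_def s sym_map_def)
  have cc: "sym_map n s a b (hi, lo) \<in> {lo, hi} \<times> {lo, hi}"
    "sym_map n s a b (lo, hi) \<in> {lo, hi} \<times> {lo, hi}"
    using hi by (auto simp: sym_map_def Let_def)
  have tgt: "\<psi> (lo, lo) = (if a then hi else lo, if b then hi else lo)"
    using hi by (simp add: s sym_map_def)
  have c0: "f0 (lo, lo) = 1" "f0 (hi, lo) = 1" "f0 (lo, hi) = 1" "f0 (hi, hi) = 1"
    using corners hi by auto
  have pre: "\<exists>u\<in>{lo, hi} \<times> {lo, hi}. ?f u = f v" if v: "v \<in> {lo, hi} \<times> {lo, hi}" for v
  proof -
    obtain u where u: "u \<in> {lo, hi} \<times> {lo, hi}" "sym_map n s a b u = v"
      using corner_preimage[OF v] by blast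
    then have "u \<in> grid_nodes n" using hi by auto
    then show ?thesis using u s by (intro bexI[of _ u]) (simp_all add: view_def del: mem_grid)
  qed
  consider "f = f0" | "departed f" | "piled f" using g(1) by (auto simp: good_def)
  then show ?thesis
  proof cases
    case 1
    then have "?f (lo, lo) = 1" "?f (hi, lo) = 1" "?f (lo, hi) = 1" using c cc c0 by auto
    then have eq: "?f = f0" using g(2) by (auto simp: good_def departed_def piled_def)
    have "f0 (\<psi> v) = f0 v" if "v \<in> grid_nodes n" for v
    proof -
      have "?f v = f (\<psi> v)" using that by (simp add: view_def)
      then show ?thesis using eq 1 by simp
    qed
    then show ?thesis using stab[OF \<psi>] by blast
  next
    case 3
    then have "\<exists>v\<in>{lo, hi} \<times> {lo, hi}. ?f v = 2" using pre[of "(lo, lo)"] by (auto simp: piled_def)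
    then have "piled ?f" using g(2) c0 by (auto simp: good_def departed_def)
    then have "f (if a then hi else lo, if b then hi else lo) = 2" using c by (simp add: piled_def)
    then show ?thesis using 3 tgt by (auto simp: piled_def split: if_splits)
  next
    case 2
    then have "\<exists>v\<in>{lo, hi} \<times> {lo, hi}. ?f v = 0"
      using pre[of "(hi, lo)"] pre[of "(lo, hi)"] by (auto simp: departed_def)
    moreover have "?f (lo, lo) \<le> 1" using c 2 by (auto simp: departed_def)
    ultimately have d: "departed ?f" using g(2) c0 by (auto simp: good_def piled_def)
    \<comment> \<open>If only one of \<open>a\<close> and \<open>b\<close> held, both ends required
      to be occupied in the view would come from \<open>(hi, lo)\<close> and
      \<open>(lo, hi)\<close>, one of which is empty.\<close>
    then have "a = b" using c 2 by (auto simp: departed_def split: if_splits)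
    moreover have False if "a" "b"
    proof -
      have "coord_sum (\<psi> v) + coord_sum v = 2 * (n - 1)" if "v \<in> grid_nodes n" for v
        using that \<open>a\<close> \<open>b\<close> by (cases v) (auto simp: s coord_sum_def sym_map_def Let_def)
      from weight_view_antipodal[OF \<psi> this, of f]
      show False using 2 d total_count_view[OF \<psi>, of f] by (simp add: departed_def)
    qed
    ultimately show ?thesis using tgt by auto
  qed
qed

lemma fixing_target:
  assumes "grid_aut n \<psi>" "\<psi> (lo, lo) = (lo, lo)"
  shows "(\<forall>v\<in>grid_nodes n. \<psi> v = v) \<or> (\<forall>v\<in>grid_nodes n. \<psi> v = prod.swap v)"
proof -
  obtain s a b where s: "\<And>v. v \<in> grid_nodes n \<Longrightarrow> \<psi> v = sym_map n s a b v"
    using grid_aut_sym_map[OF assms(1)] by metis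
  have "\<not> a" "\<not> b" using assms(2) s[of "(lo, lo)"] hi
    by (auto simp: sym_map_def Let_def split: if_splits)
  then show ?thesis using s by (cases s) (auto simp: sym_map_def)
qed

text \<open>With a pile the larger coordinate is lowered first, so that nobody steps onto another
  corner of the square; the tie \<open>x = y\<close> is the only choice that breaks transposition
  symmetry. Before that, \<open>(hi, lo)\<close> and \<open>(lo, hi)\<close> both occupied signals
  that neither corner robot has left.\<close>

fun move :: "config \<Rightarrow> node \<Rightarrow> node" where
  "move f (x, y) =
    (if f (lo, lo) = 2 then
       if y < x then (x - 1, y) else if x < y then (x, y - 1) else if lo < x then (x - 1, y) else (x, y)
     else if f (hi, lo) \<noteq> 0 \<and> f (lo, hi) \<noteq> 0 then
       if (x, y) = (hi, lo) then (x - 1, y) else if (x, y) = (lo, hi) then (x, y - 1) else (x, y)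
     else if y = lo \<and> lo < x \<and> (\<forall>i. lo < i \<and> i < x \<longrightarrow> f (i, lo) = 0) then (x - 1, y)
     else if x = lo \<and> lo < y \<and> (\<forall>i. lo < i \<and> i < y \<longrightarrow> f (lo, i) = 0) then (x, y - 1)
     else (x, y))"

declare move.simps [simp del]

lemma move_descends: "move f w = w \<or> descends w (move f w)"
  by (cases w) (auto simp: descends_def move.simps)

lemma descends_grid: "descends w w' \<Longrightarrow> w \<in> grid_nodes n \<Longrightarrow> w' \<in> grid_nodes n \<and> grid_adj w w'"
  by (cases w; cases w') (auto simp: descends_def grid_adj_def)

lemma move_valid:
  assumes "w \<in> grid_nodes n"
  shows "move f w \<in> grid_nodes n \<and> (move f w = w \<or> grid_adj w (move f w))"
  using move_descends[of f w] descends_grid assms by metis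

text \<open>A robot recovers, from its view, an automorphism that puts the configuration in normal
  form; the choice is irrelevant up to the diagonal reflection, since all such automorphisms
  agree on the target corner.\<close>

definition alg :: algorithm where
  "alg g u = (if \<exists>\<theta>. grid_aut n \<theta> \<and> good (view n \<theta> g) then
     let \<theta> = SOME \<theta>. grid_aut n \<theta> \<and> good (view n \<theta> g) in
       \<theta> (move (view n \<theta> g) (inv_into (grid_nodes n) \<theta> u)) else u)"

lemma alg_valid: "valid_alg n alg"
  unfolding valid_alg_def
proof (intro allI impI)
  fix g u assume u: "u \<in> grid_nodes n"
  show "alg g u \<in> grid_nodes n \<and> (alg g u = u \<or> grid_adj u (alg g u))"
  proof (cases "\<exists>\<theta>. grid_aut n \<theta> \<and> good (view n \<theta> g)")
    case False
    then have "alg g u = u" unfolding alg_def by (rule if_not_P)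
    then show ?thesis using u by simp
  next
    case True
    define \<theta> where "\<theta> = (SOME \<theta>. grid_aut n \<theta> \<and> good (view n \<theta> g))"
    have \<theta>: "grid_aut n \<theta>" using someI_ex[OF True] by (simp add: \<theta>_def)
    define w where "w = inv_into (grid_nodes n) \<theta> u"
    have w: "w \<in> grid_nodes n" "\<theta> w = u"
      using grid_aut_mem[OF grid_aut_inv[OF \<theta>] u] grid_aut_inv_right[OF \<theta> u] by (auto simp: w_def)
    have a: "alg g u = \<theta> (move (view n \<theta> g) w)"
      using True by (simp add: alg_def \<theta>_def w_def Let_def)
    show ?thesis unfolding a
      using move_valid[OF w(1), of "view n \<theta> g"] grid_aut_mem[OF \<theta>] grid_aut_adj[OF \<theta>] w by metis
  qed
qed

text \<open>The frame picked by \<open>SOME\<close> need not undo \<open>\<sigma>\<close>. But the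
  composite relates two good configurations, so it fixes the target and is the identity or the
  transposition; these give the two outcomes.\<close>

lemma alg_move:
  assumes f: "good f" "\<And>v. v \<notin> grid_nodes n \<Longrightarrow> f v = 0"
    and \<sigma>: "grid_aut n \<sigma>" and u: "u \<in> grid_nodes n"
  shows "\<sigma> (alg (view n \<sigma> f) u) \<in>
    {move f (\<sigma> u), prod.swap (move (view n prod.swap f) (prod.swap (\<sigma> u)))}"
proof -
  let ?g = "view n \<sigma> f"
  let ?i = "inv_into (grid_nodes n) \<sigma>"
  \<comment> \<open>The inverse of the local frame shows that the guard of \<open>alg\<close> is
    satisfied.\<close>
  have "view n ?i ?g = f"
    using f(2) grid_aut_inv_right[OF \<sigma>] grid_aut_mem[OF grid_aut_inv[OF \<sigma>]]
    by (auto simp: view_def fun_eq_iff simp del: mem_grid)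
  then have ex: "\<exists>\<theta>. grid_aut n \<theta> \<and> good (view n \<theta> ?g)" using grid_aut_inv[OF \<sigma>] f by metis
  define \<theta> where "\<theta> = (SOME \<theta>. grid_aut n \<theta> \<and> good (view n \<theta> ?g))"
  have \<theta>: "grid_aut n \<theta>" "good (view n \<theta> ?g)" using someI_ex[OF ex] by (auto simp: \<theta>_def)
  define w where "w = inv_into (grid_nodes n) \<theta> u"
  have w: "w \<in> grid_nodes n" "\<theta> w = u"
    using grid_aut_mem[OF grid_aut_inv[OF \<theta>(1)] u] grid_aut_inv_right[OF \<theta>(1) u]
    by (auto simp: w_def)
  have a: "alg ?g u = \<theta> (move (view n \<theta> ?g) w)"
    using ex by (simp add: alg_def \<theta>_def w_def Let_def)
  define \<psi> where "\<psi> = \<sigma> \<circ> \<theta>"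
  have \<psi>: "grid_aut n \<psi>" "view n \<theta> ?g = view n \<psi> f"
    using grid_aut_comp[OF \<sigma> \<theta>(1)] view_view[OF \<theta>(1)] by (auto simp: \<psi>_def)
  have m: "move (view n \<psi> f) w \<in> grid_nodes n" using move_valid[OF w(1)] by blast
  have \<psi>w: "\<psi> w = \<sigma> u" using w by (simp add: \<psi>_def)
  have e: "\<sigma> (alg ?g u) = \<psi> (move (view n \<psi> f) w)" using a \<psi>(2) by (simp add: \<psi>_def)
  have "good (view n \<psi> f)" using \<theta>(2) \<psi>(2) by simp
  from fixing_target[OF \<psi>(1) good_target[OF \<psi>(1) f(1) this]]
  show ?thesis
  proof
    assume id: "\<forall>v\<in>grid_nodes n. \<psi> v = v"
    have v: "view n \<psi> f = f"
    proof
      fix v show "view n \<psi> f v = f v"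
        using f(2)[of v] bspec[OF id, of v] by (cases "v \<in> grid_nodes n") (simp_all add: view_def)
    qed
    have "w = \<sigma> u" using id w(1) \<psi>w by simp
    moreover have "\<psi> (move f w) = move f w" using bspec[OF id m] v by simp
    ultimately show ?thesis using e v by simp
  next
    assume sw: "\<forall>v\<in>grid_nodes n. \<psi> v = prod.swap v"
    have v: "view n \<psi> f = view n prod.swap f"
    proof
      fix v show "view n \<psi> f v = view n prod.swap f v"
        using bspec[OF sw, of v] by (cases "v \<in> grid_nodes n") (simp_all add: view_def)
    qed
    have "w = prod.swap (\<sigma> u)" using bspec[OF sw w(1)] \<psi>w by (metis swap_swap)
    then show ?thesis using e v bspec[OF sw m] by simp
  qed
qed

text \<open>Without a pile \<open>move\<close> commutes with transposition, because its branches
  come in mirrored pairs that exclude each other. The two outcomes of \<open>alg_move\<close>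
  coincide.\<close>

lemma alg_before_pile:
  assumes f: "good f" "\<And>v. v \<notin> grid_nodes n \<Longrightarrow> f v = 0" "f (lo, lo) \<noteq> 2"
    and \<sigma>: "grid_aut n \<sigma>" and u: "u \<in> grid_nodes n"
  shows "\<sigma> (alg (view n \<sigma> f) u) = move f (\<sigma> u)"
proof -
  obtain x y where xy: "\<sigma> u = (x, y)" by fastforce
  then have l: "x < n" "y < n" using grid_aut_mem[OF \<sigma> u] by auto
  let ?g = "view n prod.swap f"
  have g: "?g (i, j) = f (j, i)" if "i < n" "j < n" for i j using that by (simp add: view_def)
  define P Q where "P \<longleftrightarrow> (\<forall>i. lo < i \<and> i < x \<longrightarrow> f (i, lo) = 0)"
    and "Q \<longleftrightarrow> (\<forall>i. lo < i \<and> i < y \<longrightarrow> f (lo, i) = 0)"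
  have PQ: "(\<forall>i. lo < i \<and> i < y \<longrightarrow> ?g (i, lo) = 0) \<longleftrightarrow> Q"
    "(\<forall>i. lo < i \<and> i < x \<longrightarrow> ?g (lo, i) = 0) \<longleftrightarrow> P"
    using l hi(3) by (auto simp: g P_def Q_def)
  have "prod.swap (move ?g (y, x)) = move f (x, y)"
    unfolding move.simps g[OF hi(3) hi(3)] g[OF hi(2) hi(3)] g[OF hi(3) hi(2)] PQ
      P_def[symmetric] Q_def[symmetric]
    using f(3) hi(1) by (cases P; cases Q) auto
  then show ?thesis using alg_move[OF f(1,2) \<sigma> u] xy by auto
qed

text \<open>On the diagonal the outcomes of \<open>alg_move\<close> differ, but either one lowers a
  coordinate and, because \<open>lo + 2 \<le> hi\<close>, avoids the other corners.\<close>

lemma alg_after_pile: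
  assumes f: "good f" "\<And>v. v \<notin> grid_nodes n \<Longrightarrow> f v = 0" "f (lo, lo) = 2"
    and \<sigma>: "grid_aut n \<sigma>" and u: "u \<in> grid_nodes n" and sq: "\<sigma> u \<in> centered_square n lo"
  shows "let w = \<sigma> u; w' = \<sigma> (alg (view n \<sigma> f) u) in
    w' \<in> centered_square n lo \<and> w' \<notin> {(hi, lo), (lo, hi), (hi, hi)} \<union> {w} \<and> descends w w' \<or> w' = w \<and> w = (lo, lo)"
proof -
  obtain x y where xy: "\<sigma> u = (x, y)" by fastforce
  have l: "lo \<le> x" "x \<le> hi" "lo \<le> y" "y \<le> hi"
    using sq xy hi by (auto simp: centered_square_def)
  have "\<sigma> (alg (view n \<sigma> f) u) \<in>
    {move f (x, y), prod.swap (move (view n prod.swap f) (y, x))}"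
    using alg_move[OF f(1,2) \<sigma> u] xy by auto
  then have "\<sigma> (alg (view n \<sigma> f) u) \<in> (if y < x then {(x - 1, y)} else if x < y then {(x, y - 1)}
      else if lo < x then {(x - 1, y), (x, y - 1)} else {(x, y)})"
    using f(3) hi by (auto simp: move.simps view_def)
  then show ?thesis unfolding xy Let_def
    using l hi by (auto simp: descends_def centered_square_def split: if_splits)
qed

end

section \<open>Executions of the algorithm\<close>

lemma config_of_eq_min: "config_of k p v = min 2 (card {r. r < k \<and> p r = v})"
proof -
  have "(if c = 0 then 0 else if c = 1 then 1 else 2) = min 2 c" for c :: nat by auto
  then show ?thesis unfolding config_of_def Let_def .
qed

lemma config_of_eq_0: "config_of k p v = 0 \<longleftrightarrow> (\<forall>r<k. p r \<noteq> v)"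
proof -
  have "config_of k p v = 0 \<longleftrightarrow> card {r. r < k \<and> p r = v} = 0"
    unfolding config_of_eq_min by linarith
  then show ?thesis by auto
qed

lemma config_of_le_1:
  assumes "\<And>r r'. r < k \<Longrightarrow> r' < k \<Longrightarrow> p r = v \<Longrightarrow> p r' = v \<Longrightarrow> r = r'"
  shows "config_of k p v \<le> 1"
proof -
  have "card {r. r < k \<and> p r = v} \<le> Suc 0"
    using assms by (subst card_le_Suc0_iff_eq) auto
  then show ?thesis unfolding config_of_eq_min by linarith
qed

lemma config_of_eq_1:
  assumes "r < k" "p r = v" "\<And>r'. r' < k \<Longrightarrow> p r' = v \<Longrightarrow> r' = r"
  shows "config_of k p v = 1"
proof -
  have "config_of k p v \<le> 1" using assms(3) by (intro config_of_le_1) metis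
  moreover have "config_of k p v \<noteq> 0" using assms by (auto simp: config_of_eq_0)
  ultimately show ?thesis by simp
qed

lemma config_of_eq_2:
  assumes "r < k" "r' < k" "r \<noteq> r'" "p r = v" "p r' = v"
  shows "config_of k p v = 2"
proof -
  have "card {r, r'} \<le> card {r. r < k \<and> p r = v}" by (rule card_mono) (use assms in auto)
  moreover have "card {r, r'} = 2" using assms(3) by simp
  ultimately show ?thesis unfolding config_of_eq_min by linarith
qed

lemma config_of_card:
  assumes "card {r. r < k \<and> p r = v} \<le> 2"
  shows "config_of k p v = card {r. r < k \<and> p r = v}"
  using assms unfolding config_of_eq_min by linarith

text \<open>With at most two robots per node the truncation loses nothing, so a sum over visible
  counts is a sum over robots.\<close>

lemma sum_config_of:
  fixes g :: "node \<Rightarrow> nat"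
  assumes "\<And>v. card {r. r < k \<and> p r = v} \<le> 2" "\<And>r. r < k \<Longrightarrow> p r \<in> grid_nodes n"
  shows "(\<Sum>v\<in>grid_nodes n. config_of k p v * g v) = (\<Sum>r<k. g (p r))"
proof -
  have eq: "config_of k p v * g v = (\<Sum>r\<in>{r \<in> {..<k}. p r = v}. g (p r))" for v
    by (simp add: config_of_card[OF assms(1)])
  show ?thesis unfolding eq
  proof (rule sum.group)
    show "finite (grid_nodes n)" by (simp add: grid_nodes_def)
    show "p ` {..<k} \<subseteq> grid_nodes n" using assms(2) by blast
  qed simp
qed

lemma antimono_nat_eventually_const:
  fixes H :: "nat \<Rightarrow> nat"
  assumes "\<And>t. H (Suc t) \<le> H t"
  shows "\<exists>T. \<forall>t\<ge>T. H t = H T"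
proof -
  obtain T where T: "\<And>t. H T \<le> H t" using ex_has_least_nat[of "\<lambda>_. True" 0 H] by blast
  have "H t \<le> H T" if "t \<ge> T" for t using that
    by (induction t rule: dec_induct) (use assms le_trans in blast)+
  then show ?thesis using T le_antisym by blast
qed

section \<open>The invariant of an execution\<close>

locale run = normal_form +
  fixes k :: nat and pos :: "nat \<Rightarrow> nat \<Rightarrow> node" and pend :: "nat \<Rightarrow> nat \<Rightarrow> node option"
    and act :: "nat \<Rightarrow> nat" and crash :: "(nat \<times> nat) option"
  assumes ex: "lcm_execution n alg k f0 pos pend act crash"
begin

lemmas E = lcm_executionD[OF ex]

abbreviation "S \<equiv> centered_square n lo"

abbreviation "cfg t \<equiv> config_of k (pos t)"

lemma mem_S: "(x, y) \<in> S \<longleftrightarrow> lo \<le> x \<and> x \<le> hi \<and> lo \<le> y \<and> y \<le> hi"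
  using hi by (auto simp: centered_square_def)

definition far :: "node set" where "far = {(hi, lo), (lo, hi), (hi, hi)}"

definition D :: nat where "D = hi - lo"

lemma D: "2 \<le> D" "lo + D = hi" using hi by (auto simp: D_def)

text \<open>Both edges at the target are parametrised by the distance from it, so that each argument
  is made once for a boolean \<open>s\<close>.\<close>

definition nd :: "bool \<Rightarrow> nat \<Rightarrow> node" where
  "nd s i = (if s then (lo, lo + i) else (lo + i, lo))"

lemma nd_0 [simp]: "nd s 0 = (lo, lo)" by (simp add: nd_def)

lemma nd_eq: "0 < i \<Longrightarrow> nd s i = nd s' j \<longleftrightarrow> s = s' \<and> i = j"
  by (auto simp: nd_def)

lemma nd_eq_base: "nd s i = (lo, lo) \<longleftrightarrow> i = 0" by (auto simp: nd_def)

lemma nd_D: "nd False D = (hi, lo)" "nd True D = (lo, hi)" using D by (auto simp: nd_def)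

lemma nd_D_far: "nd s D \<in> far" by (cases s) (auto simp: nd_D far_def)

lemma coord_sum_nd: "coord_sum (nd s i) = 2 * lo + i" by (auto simp: coord_sum_def nd_def)

lemma f0_corners: "f0 (lo, lo) = 1" "f0 (hi, lo) = 1" "f0 (lo, hi) = 1" "f0 (hi, hi) = 1"
  "f0 (nd s D) = 1"
  using corners hi by (cases s; simp add: nd_D)+

definition rob :: "node \<Rightarrow> nat" where "rob v = (THE r. r < k \<and> pos 0 r = v)"

lemma rob_unique: "r < k \<Longrightarrow> r' < k \<Longrightarrow> pos 0 r = pos 0 r' \<Longrightarrow> r = r'"
  using E(1) by (auto simp: inj_on_def)

lemma rob_eq: "r < k \<Longrightarrow> pos 0 r = v \<Longrightarrow> rob v = r"
  unfolding rob_def using rob_unique by blast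

lemma rob: "f0 v \<noteq> 0 \<Longrightarrow> rob v < k \<and> pos 0 (rob v) = v"
  using E(3) config_of_eq_0[of k "pos 0" v] rob_eq by metis

lemma f0_pos: "r < k \<Longrightarrow> f0 (pos 0 r) \<noteq> 0"
  using E(3) config_of_eq_0[of k "pos 0"] by metis

text \<open>The starting distance of the leader of edge \<open>s\<close>. After a departure and
  before the pile, no robot farther out on that edge is enabled.\<close>

definition m :: "bool \<Rightarrow> nat" where "m s = (LEAST i. 0 < i \<and> f0 (nd s i) \<noteq> 0)"

lemma m: "0 < m s" "f0 (nd s (m s)) \<noteq> 0" "0 < i \<Longrightarrow> f0 (nd s i) \<noteq> 0 \<Longrightarrow> m s \<le> i" "m s \<le> D"
proof -
  have *: "0 < D \<and> f0 (nd s D) \<noteq> 0" using D f0_corners by simp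
  show "0 < m s" "f0 (nd s (m s)) \<noteq> 0"
    using LeastI[of "\<lambda>i. 0 < i \<and> f0 (nd s i) \<noteq> 0", OF *] by (auto simp: m_def)
  show "0 < i \<Longrightarrow> f0 (nd s i) \<noteq> 0 \<Longrightarrow> m s \<le> i" "m s \<le> D"
    using * by (auto simp: m_def intro: Least_le)
qed

text \<open>On the edge s, the leading robot is ml and the robot of the far corner is ma; they coincide
  when no other robot is on the edge.\<close>

definition ml :: "bool \<Rightarrow> nat" where "ml s = rob (nd s (m s))"
definition ma :: "bool \<Rightarrow> nat" where "ma s = rob (nd s D)"
definition base :: nat where "base = rob (lo, lo)"

lemma ml: "ml s < k" "pos 0 (ml s) = nd s (m s)" using rob[OF m(2)] by (auto simp: ml_def)
lemma ma: "ma s < k" "pos 0 (ma s) = nd s D" using rob f0_corners(5) by (auto simp: ma_def)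
lemma base: "base < k" "pos 0 base = (lo, lo)" using rob f0_corners by (auto simp: base_def)

lemma ml_base: "ml s \<noteq> base"
proof
  assume "ml s = base"
  then have "nd s (m s) = (lo, lo)" using ml[of s] base by simp
  then show False using m(1)[of s] by (simp add: nd_eq_base)
qed

lemma ma_base: "ma s \<noteq> base"
proof
  assume "ma s = base"
  then have "nd s D = (lo, lo)" using ma[of s] base by simp
  then show False using D(1) by (simp add: nd_eq_base)
qed

definition pre :: "nat \<Rightarrow> bool" where
  "pre t \<longleftrightarrow> (\<forall>r<k. pos t r = (lo, lo) \<longrightarrow> r = base)"

text \<open>A pending move may outlive the phase in which it was decided, so only facts valid in
  every phase are recorded about it.\<close>

definition sq :: "nat \<Rightarrow> nat \<Rightarrow> bool" where
  "sq t r \<longleftrightarrow> pos t r \<in> S \<and> (\<forall>w. pend t r = Some w \<longrightarrow>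
     w = pos t r \<or> descends (pos t r) w \<and> w \<in> S \<and> w \<notin> far)"

definition on_side :: "nat \<Rightarrow> bool \<Rightarrow> nat \<Rightarrow> nat \<Rightarrow> bool" where
  "on_side t s r i \<longleftrightarrow> 0 < i \<and> pos t r = nd s i \<and> pend t r \<in> {None, Some (nd s i), Some (nd s (i - 1))}"

definition still :: "nat \<Rightarrow> nat \<Rightarrow> bool" where
  "still t r \<longleftrightarrow> pos t r = pos 0 r \<and> pend t r \<in> {None, Some (pos 0 r)}"

definition lead :: "nat \<Rightarrow> bool \<Rightarrow> bool" where
  "lead t s \<longleftrightarrow> (\<exists>i\<le>m s. on_side t s (ml s) i)"

text \<open>A corner robot with a robot ahead of it makes at most one step, so that at most two robots
  ever share a node of the edge.\<close>

definition tail :: "nat \<Rightarrow> bool \<Rightarrow> bool" where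
  "tail t s \<longleftrightarrow> (\<exists>i\<le>D. on_side t s (ma s) i \<and>
     (m s < D - 1 \<longrightarrow> i = D \<or> i = D - 1 \<and> pend t (ma s) \<noteq> Some (nd s (i - 1))))"

lemma lead_pos: "lead t s \<Longrightarrow> \<exists>i. 0 < i \<and> i \<le> m s \<and> pos t (ml s) = nd s i"
  unfolding lead_def on_side_def by blast

lemma tail_pos: "tail t s \<Longrightarrow> \<exists>i. 0 < i \<and> i \<le> D \<and> pos t (ma s) = nd s i"
  unfolding tail_def on_side_def by blast

definition unmoved :: "nat \<Rightarrow> bool" where
  "unmoved t \<longleftrightarrow> pos t (ma False) = nd False D \<and> pos t (ma True) = nd True D"

text \<open>The at most four robots that can leave their initial nodes before the pile
  forms.\<close>

definition mobile :: "nat set" where "mobile = range ml \<union> range ma"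

text \<open>The last conjunct keeps the configuration equal to \<open>f0\<close> until a corner
  robot really leaves; up to then only corner robots can hold a pending move away from their
  nodes.\<close>

definition legal_before_pile :: "nat \<Rightarrow> bool" where
  "legal_before_pile t \<longleftrightarrow> (\<forall>s. lead t s) \<and> (\<forall>s. tail t s) \<and> (\<forall>r<k. r \<notin> mobile \<longrightarrow> still t r) \<and>
     (unmoved t \<longrightarrow> (\<forall>r<k. pos t r = pos 0 r \<and> (r \<notin> range ma \<longrightarrow> still t r)))"

text \<open>The second conjunct bounds the count at each far corner by one, since the initial
  positions are distinct.\<close>

definition legal :: "nat \<Rightarrow> bool" where
  "legal t \<longleftrightarrow> (\<forall>r<k. sq t r) \<and> (\<forall>r<k. pos t r \<in> far \<longrightarrow> pos 0 r = pos t r) \<and>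
     pos t base = (lo, lo) \<and> (pre t \<longrightarrow> legal_before_pile t)"

lemma legal_0: "legal 0"
proof -
  have "sq 0 r" if "r < k" for r
    using supp[OF f0_pos[OF that]] E(4)[OF that] by (simp add: sq_def)
  moreover have "legal_before_pile 0"
    unfolding legal_before_pile_def
  proof (intro conjI allI impI)
    show "lead 0 s" for s unfolding lead_def on_side_def
      using ml[of s] m(1)[of s] E(4)[OF ml(1)] by (intro exI[of _ "m s"]) auto
    show "tail 0 s" for s unfolding tail_def on_side_def
      using ma[of s] D(1) E(4)[OF ma(1)] by (intro exI[of _ D]) auto
  qed (use E(4) in \<open>auto simp: still_def\<close>)
  ultimately show ?thesis using base by (auto simp: legal_def)
qed

text \<open>At the target and off the two edges only the initial occupant can be present. At an edge
  node whose initial occupant is not mobile, the leader is already strictly nearer to the target, so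
  only the corner robot can join; at the remaining edge nodes only the leader and the corner robot
  can be.\<close>

lemma legal_before_pile_card:
  assumes "legal_before_pile t"
  shows "card {r. r < k \<and> pos t r = v} \<le> 2"
proof -
  have L: "lead t s" "tail t s" for s using assms by (auto simp: legal_before_pile_def)
  have R: "r < k \<Longrightarrow> r \<notin> mobile \<Longrightarrow> pos t r = pos 0 r" for r
    using assms by (auto simp: legal_before_pile_def still_def)
  have two: ?thesis if "{r. r < k \<and> pos t r = v} \<subseteq> {u, w}" for u w
    using card_mono[OF _ that] card_insert_le_m1[of 2 "{w}" u] by (simp add: le_trans)
  show ?thesis
  proof (cases "\<exists>s i. 0 < i \<and> v = nd s i")
    case False
    then have no: "pos t (ml s) \<noteq> v" "pos t (ma s) \<noteq> v" for s
      using False lead_pos[OF L(1), of s] tail_pos[OF L(2), of s] by metis+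
    have "{r. r < k \<and> pos t r = v} \<subseteq> {rob v, rob v}"
    proof
      fix r assume r: "r \<in> {r. r < k \<and> pos t r = v}"
      then have "r \<notin> mobile" using no by (auto simp: mobile_def)
      then show "r \<in> {rob v, rob v}" using r R[of r] rob_eq[of r v] by auto
    qed
    then show ?thesis by (rule two)
  next
    case True
    then obtain s i where si: "0 < i" "v = nd s i" by blast
    have o: "pos t (ml s') \<noteq> v" "pos t (ma s') \<noteq> v" if "s' \<noteq> s" for s'
      using lead_pos[OF L(1), of s'] tail_pos[OF L(2), of s'] si that nd_eq by auto
    show ?thesis
    proof (cases "rob v < k \<and> pos 0 (rob v) = v \<and> rob v \<notin> mobile")
      case False
      have "{r. r < k \<and> pos t r = v} \<subseteq> {ml s, ma s}"
      proof
        fix r assume r: "r \<in> {r. r < k \<and> pos t r = v}"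
        have "r \<in> mobile"
        proof (rule ccontr)
          assume *: "r \<notin> mobile"
          then have "pos 0 r = v" using R r by auto
          then show False using rob_eq[of r v] r * False by auto
        qed
        then obtain s' where "r = ml s' \<or> r = ma s'" by (auto simp: mobile_def)
        then show "r \<in> {ml s, ma s}" using r o by (cases "s' = s") auto
      qed
      then show ?thesis by (rule two)
    next
      case True
      then have "f0 v \<noteq> 0" using f0_pos by metis
      then have "m s \<le> i" using m(3) si by blast
      moreover have "i \<noteq> m s" using True si by (auto simp: mobile_def ml_def)
      moreover obtain j where "j \<le> m s" "pos t (ml s) = nd s j"
        using lead_pos[OF L(1), of s] by blast
      ultimately have nl: "pos t (ml s) \<noteq> v" using si nd_eq[of i s s j] by auto
      have "{r. r < k \<and> pos t r = v} \<subseteq> {rob v, ma s}"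
      proof
        fix r assume r: "r \<in> {r. r < k \<and> pos t r = v}"
        show "r \<in> {rob v, ma s}"
        proof (cases "r \<in> mobile")
          case False
          then show ?thesis using R[of r] r rob_eq[of r v] by auto
        next
          case True
          then obtain s' where "r = ml s' \<or> r = ma s'" by (auto simp: mobile_def)
          then show ?thesis using r o nl by (cases "s' = s") auto
        qed
      qed
      then show ?thesis by (rule two)
    qed
  qed
qed

lemma legal_before_pile_coord_sum:
  assumes "legal_before_pile t" "r < k"
  shows "coord_sum (pos t r) \<le> coord_sum (pos 0 r)"
proof (cases "r \<in> mobile")
  case False
  then show ?thesis using assms by (auto simp: legal_before_pile_def still_def)
next
  case True
  then obtain s where "r = ml s \<or> r = ma s" by (auto simp: mobile_def)
  moreover have "lead t s" "tail t s" using assms by (auto simp: legal_before_pile_def)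
  ultimately show ?thesis
    using ml(2)[of s] ma(2)[of s] lead_pos[of t s] tail_pos[of t s] by (auto simp: coord_sum_nd)
qed

text \<open>A departed corner robot has a smaller coordinate sum than at the start and no other
  robot has a larger one. As counts are exact, this makes \<open>balance\<close> strict and so
  resolves a possible tie between the ends.\<close>

lemma legal_before_pile_balance:
  assumes "legal_before_pile t" "\<not> unmoved t" and grid: "\<And>r. r < k \<Longrightarrow> pos t r \<in> grid_nodes n"
  shows "weight n (cfg t) < (n - 1) * total_count n (cfg t)"
proof -
  obtain s where s: "pos t (ma s) \<noteq> nd s D" using assms(2) by (auto simp: unmoved_def)
  have "tail t s" using assms by (auto simp: legal_before_pile_def)
  then have lt: "coord_sum (pos t (ma s)) < coord_sum (pos 0 (ma s))"
    using s ma(2)[of s] tail_pos[of t s] by (auto simp: coord_sum_nd le_less)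
  have c0: "card {r. r < k \<and> pos 0 r = v} \<le> 2" for v
  proof -
    have "legal_before_pile 0" if "pre 0" using legal_0 that by (simp add: legal_def)
    moreover have "pre 0" using base rob_unique by (auto simp: pre_def)
    ultimately show ?thesis using legal_before_pile_card by blast
  qed
  have "weight n (cfg t) = (\<Sum>r<k. coord_sum (pos t r))"
    unfolding weight_def by (rule sum_config_of) (use legal_before_pile_card[OF assms(1)] grid in auto)
  also have "\<dots> < (\<Sum>r<k. coord_sum (pos 0 r))"
    using legal_before_pile_coord_sum[OF assms(1)] lt ma(1) by (intro sum_strict_mono_ex1) auto
  also have "\<dots> = weight n f0"
    unfolding weight_def E(3)[symmetric] by (rule sum_config_of[symmetric]) (use c0 E(2) in auto)
  also have "\<dots> \<le> (n - 1) * total_count n f0" by (rule balance)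
  also have "total_count n f0 = total_count n (cfg t)"
    unfolding total_count_def E(3)[symmetric]
    using sum_config_of[of k "pos 0" n "\<lambda>_. 1"] c0 E(2)
      sum_config_of[of k "pos t" n "\<lambda>_. 1"] legal_before_pile_card[OF assms(1)] grid by simp
  finally show ?thesis .
qed

section \<open>The target stays recognisable; which robots are enabled\<close>

lemma pos_grid: "r < k \<Longrightarrow> pos t r \<in> grid_nodes n"
  using execution_in_grid[OF alg_valid ex] by blast

lemma cfg_outside: "v \<notin> grid_nodes n \<Longrightarrow> cfg t v = 0"
  using pos_grid by (auto simp: config_of_eq_0)

lemma far_le_1:
  assumes "legal t" "v \<in> far"
  shows "cfg t v \<le> 1"
proof (rule config_of_le_1)
  fix r r' assume r: "r < k" "r' < k" "pos t r = v" "pos t r' = v"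
  then have "pos 0 r = v" "pos 0 r' = v" using assms unfolding legal_def by metis+
  then show "r = r'" using rob_unique[OF r(1,2)] by simp
qed

lemma base_count:
  assumes "legal t"
  shows "cfg t (lo, lo) = (if pre t then 1 else 2)"
proof (cases "pre t")
  case True
  have "pos t base = (lo, lo)" using assms by (simp add: legal_def)
  then have "cfg t (lo, lo) = 1"
    by (rule config_of_eq_1[OF base(1)]) (use True in \<open>unfold pre_def, blast\<close>)
  then show ?thesis using True by simp
next
  case False
  then obtain r where "r < k" "pos t r = (lo, lo)" "r \<noteq> base" by (auto simp: pre_def)
  moreover have "pos t base = (lo, lo)" using assms by (simp add: legal_def)
  ultimately have "cfg t (lo, lo) = 2"
    using config_of_eq_2[OF base(1)] by metis
  then show ?thesis using False by simp
qed

lemma corner_occupied: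
  assumes "legal t"
  shows "cfg t (nd s D) \<noteq> 0 \<longleftrightarrow> pos t (ma s) = nd s D"
proof
  assume "cfg t (nd s D) \<noteq> 0"
  then obtain r where r: "r < k" "pos t r = nd s D" by (auto simp: config_of_eq_0)
  then have "pos 0 r = nd s D" using assms nd_D_far by (metis legal_def)
  then show "pos t (ma s) = nd s D" using r rob_eq by (auto simp: ma_def)
qed (use ma(1) in \<open>auto simp: config_of_eq_0\<close>)

lemma unmoved_iff:
  assumes "legal t"
  shows "unmoved t \<longleftrightarrow> cfg t (hi, lo) \<noteq> 0 \<and> cfg t (lo, hi) \<noteq> 0"
  using corner_occupied[OF assms, of False] corner_occupied[OF assms, of True]
  by (simp add: unmoved_def nd_D)

lemma legal_good:
  assumes "legal t"
  shows "good (cfg t)"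
proof (cases "pre t")
  case False
  then have "piled (cfg t)"
    using base_count[OF assms] far_le_1[OF assms] by (auto simp: piled_def far_def)
  then show ?thesis by (simp add: good_def)
next
  case True
  then have P: "legal_before_pile t" using assms by (simp add: legal_def)
  show ?thesis
  proof (cases "unmoved t")
    case True
    then have "\<And>r. r < k \<Longrightarrow> pos t r = pos 0 r" using P by (auto simp: legal_before_pile_def)
    then have "{r. r < k \<and> pos t r = v} = {r. r < k \<and> pos 0 r = v}" for v by auto
    then have "cfg t = config_of k (pos 0)" by (simp add: config_of_def fun_eq_iff)
    then show ?thesis using E(3) by (simp add: good_def)
  next
    case False
    have far: "cfg t (hi, hi) \<le> 1" "cfg t (hi, lo) \<le> 1" "cfg t (lo, hi) \<le> 1"
      using far_le_1[OF assms] by (auto simp: far_def)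
    \<comment> \<open>The robot opposite the target lies on neither edge, so it stays and keeps the
      diagonal occupied at both ends.\<close>
    have "rob (hi, hi) \<notin> mobile"
    proof
      assume "rob (hi, hi) \<in> mobile"
      then obtain s where "rob (hi, hi) = ml s \<or> rob (hi, hi) = ma s" by (auto simp: mobile_def)
      then have "(hi, hi) = nd s (m s) \<or> (hi, hi) = nd s D"
        using rob[of "(hi, hi)"] f0_corners(4) ml(2)[of s] ma(2)[of s] by auto
      then show False using hi(1) by (auto simp: nd_def split: if_splits)
    qed
    then have "pos t (rob (hi, hi)) = (hi, hi)" "rob (hi, hi) < k"
      using P rob[of "(hi, hi)"] f0_corners(4) by (auto simp: legal_before_pile_def still_def)
    then have "cfg t (hi, hi) \<noteq> 0" by (auto simp: config_of_eq_0)
    then have "departed (cfg t)"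
      using far base_count[OF assms] True unmoved_iff[OF assms] False legal_before_pile_balance[OF P False pos_grid]
      by (auto simp: departed_def)
    then show ?thesis by (simp add: good_def)
  qed
qed

lemma move_before_pile:
  assumes f: "f (lo, lo) \<noteq> 2" and w: "w \<in> S" and mv: "move f w \<noteq> w"
  shows "\<exists>s i. 0 < i \<and> i \<le> D \<and> w = nd s i \<and> move f w = nd s (i - 1) \<and>
    (if f (hi, lo) \<noteq> 0 \<and> f (lo, hi) \<noteq> 0 then i = D else \<forall>j. 0 < j \<and> j < i \<longrightarrow> f (nd s j) = 0)"
proof -
  obtain x y where xy: "w = (x, y)" by fastforce
  have l: "lo \<le> x" "x \<le> hi" "lo \<le> y" "y \<le> hi" using w xy mem_S by auto
  show ?thesis
  proof (cases "f (hi, lo) \<noteq> 0 \<and> f (lo, hi) \<noteq> 0")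
    case True
    then have "x = hi \<and> y = lo \<or> x = lo \<and> y = hi"
      using f mv unfolding xy move.simps by (auto split: if_splits)
    then show ?thesis
    proof
      assume "x = hi \<and> y = lo"
      then show ?thesis using f True D hi(1) unfolding xy
        by (intro exI[of _ False] exI[of _ D]) (auto simp: move.simps nd_def)
    next
      assume "x = lo \<and> y = hi"
      then show ?thesis using f True D hi(1) unfolding xy
        by (intro exI[of _ True] exI[of _ D]) (auto simp: move.simps nd_def)
    qed
  next
    case False
    define A B where "A \<longleftrightarrow> y = lo \<and> lo < x \<and> (\<forall>i. lo < i \<and> i < x \<longrightarrow> f (i, lo) = 0)"
      and "B \<longleftrightarrow> x = lo \<and> lo < y \<and> (\<forall>i. lo < i \<and> i < y \<longrightarrow> f (lo, i) = 0)"
    have e: "move f w = (if A then (x - 1, y) else if B then (x, y - 1) else (x, y))"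
      unfolding xy move.simps A_def[symmetric] B_def[symmetric] using f False by auto
    then have "A \<and> move f w = (x - 1, y) \<or> B \<and> move f w = (x, y - 1)"
      using mv xy by (auto split: if_splits)
    then consider "y = lo" "lo < x" "\<forall>i. lo < i \<and> i < x \<longrightarrow> f (i, lo) = 0" "move f w = (x - 1, y)"
      | "x = lo" "lo < y" "\<forall>i. lo < i \<and> i < y \<longrightarrow> f (lo, i) = 0" "move f w = (x, y - 1)"
      unfolding A_def B_def by blast
    then show ?thesis
    proof cases
      case 1
      then show ?thesis using l D(2) False unfolding xy
        by (intro exI[of _ False] exI[of _ "x - lo"]) (auto simp: nd_def)
    next
      case 2
      then show ?thesis using l D(2) False unfolding xy
        by (intro exI[of _ True] exI[of _ "y - lo"]) (auto simp: nd_def)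
    qed
  qed
qed

lemma nd_step:
  assumes "0 < i" "i \<le> D"
  shows "descends (nd s i) (nd s (i - 1)) \<and> nd s (i - 1) \<in> S \<and> nd s (i - 1) \<notin> far"
  using assms D hi(1) by (cases s) (auto simp: descends_def nd_def far_def mem_S)

text \<open>This hides frames and views from the rest of the argument. With a pile only progress is
  asserted, because the direction chosen on the diagonal depends on the frame.\<close>

lemma look:
  assumes I: "legal t" and r: "act t = r" "pend t r = None"
  obtains w where "pend (Suc t) r = Some w"
    "w = pos t r \<or> descends (pos t r) w \<and> w \<in> S \<and> w \<notin> far"
    "pre t \<Longrightarrow> w = move (cfg t) (pos t r)"
    "\<not> pre t \<Longrightarrow> w = pos t r \<Longrightarrow> pos t r = (lo, lo)"
proof -
  have rk: "r < k" using E(5) r by blast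
  have p: "pos t r \<in> S" using I rk by (auto simp: legal_def sq_def)
  obtain \<sigma> u where \<sigma>: "grid_aut n \<sigma>" "u \<in> grid_nodes n" "\<sigma> u = pos t r"
    and w: "pend (Suc t) r = Some (\<sigma> (alg (view n \<sigma> (cfg t)) u))"
    using E(10)[of t] r by auto
  let ?w = "\<sigma> (alg (view n \<sigma> (cfg t)) u)"
  show ?thesis
  proof (cases "pre t")
    case True
    then have f: "cfg t (lo, lo) \<noteq> 2" using base_count[OF I] by simp
    have e: "?w = move (cfg t) (pos t r)"
      using alg_before_pile[OF legal_good[OF I] cfg_outside f \<sigma>(1,2)] \<sigma>(3) by simp
    have "?w = pos t r \<or> descends (pos t r) ?w \<and> ?w \<in> S \<and> ?w \<notin> far"
      using move_before_pile[of "cfg t" "pos t r", OF f p] nd_step unfolding e by metis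
    then show ?thesis using that w e True by blast
  next
    case False
    then have f: "cfg t (lo, lo) = 2" using base_count[OF I] by simp
    have "?w \<in> S \<and> ?w \<notin> far \<union> {pos t r} \<and> descends (pos t r) ?w
        \<or> ?w = pos t r \<and> pos t r = (lo, lo)"
      using alg_after_pile[OF legal_good[OF I] cfg_outside f \<sigma>(1,2)] \<sigma>(3) p
      by (simp add: Let_def far_def)
    then show ?thesis using that[OF w] False by auto
  qed
qed

text \<open>After a departure the leader's node blocks everything farther out, so an enabled robot
  is at distance at most \<open>m s\<close>. Only the leader can be there, or the corner robot if it
  started at most one node behind the leader.\<close>

lemma looker_mobile:
  assumes I: "legal t" "pre t" and rk: "r < k" and mv: "move (cfg t) (pos t r) \<noteq> pos t r"
  obtains s i where "0 < i" "pos t r = nd s i" "move (cfg t) (pos t r) = nd s (i - 1)"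
    "if unmoved t then r = ma s \<and> i = D else r = ml s \<or> r = ma s \<and> \<not> m s < D - 1"
proof -
  have P: "legal_before_pile t" using I by (simp add: legal_def)
  have L: "lead t s" "tail t s" for s using P by (auto simp: legal_before_pile_def)
  have "cfg t (lo, lo) \<noteq> 2" using base_count[OF I(1)] I(2) by simp
  moreover have "pos t r \<in> S" using I rk by (auto simp: legal_def sq_def)
  ultimately obtain s i where si: "0 < i" "i \<le> D" "pos t r = nd s i"
      "move (cfg t) (pos t r) = nd s (i - 1)"
    and c: "if unmoved t then i = D else \<forall>j. 0 < j \<and> j < i \<longrightarrow> cfg t (nd s j) = 0"
    using move_before_pile[of "cfg t" "pos t r", OF _ _ mv] unfolding unmoved_iff[OF I(1), symmetric] by metis
  have "if unmoved t then r = ma s \<and> i = D else r = ml s \<or> r = ma s \<and> \<not> m s < D - 1"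
  proof (cases "unmoved t")
    case True
    then have "i = D" using c by simp
    moreover from this have "pos 0 r = nd s D"
      using I(1) rk si(3) nd_D_far[of s] by (metis legal_def)
    ultimately show ?thesis using True rob_eq[OF rk] by (simp add: ma_def)
  next
    case False
    obtain j where j: "0 < j" "j \<le> m s" "pos t (ml s) = nd s j" using lead_pos[OF L(1)] by blast
    then have "cfg t (nd s j) \<noteq> 0" using ml(1) by (auto simp: config_of_eq_0)
    then have "\<not> j < i" using c False j(1) by auto
    then have im: "i \<le> m s" using j(2) by simp
    show ?thesis
    proof (cases "r \<in> mobile")
      case False
      then have p0: "pos 0 r = nd s i" using P rk si(3) by (auto simp: legal_before_pile_def still_def)
      then have "m s \<le> i" using m(3)[OF si(1)] f0_pos[OF rk] by simp
      then have "ml s = r" using im p0 rob_eq[OF rk] by (simp add: ml_def)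
      then show ?thesis using False by (auto simp: mobile_def)
    next
      case True
      then obtain s' where s': "r = ml s' \<or> r = ma s'" by (auto simp: mobile_def)
      then obtain i' where "pos t r = nd s' i'"
        using lead_pos[OF L(1), of s'] tail_pos[OF L(2), of s'] by blast
      then have "s' = s" using si nd_eq[OF si(1), of s s' i'] by simp
      \<comment> \<open>A corner robot with the leader well ahead stays at distance at least
        \<open>D - 1\<close>, beyond the bound \<open>i \<le> m s\<close>.\<close>
      moreover have "\<not> m s < D - 1" if "r = ma s"
      proof
        assume md: "m s < D - 1"
        obtain i' where "0 < i'" "pos t (ma s) = nd s i'" "i' = D \<or> i' = D - 1"
          using L(2)[of s] md by (auto simp: tail_def on_side_def)
        then have "i = D \<or> i = D - 1" using that si nd_eq by auto
        then show False using im md by linarith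
      qed
      ultimately show ?thesis using s' False by auto
    qed
  qed
  then show ?thesis using that si by blast
qed

section \<open>Preservation of the invariant\<close>

lemma descend_from_base: "descends (lo, lo) w \<Longrightarrow> w \<notin> S"
  by (cases w) (auto simp: descends_def mem_S)

lemma legal_look:
  assumes I: "legal t" and r: "act t = r" "pend t r = None"
  shows "legal (Suc t)"
proof -
  have rk: "r < k" using E(5) r by blast
  have same: "pos (Suc t) q = pos t q" if "q < k" for q
    using E(7)[OF that, of t] E(9)[of t] r by (cases "q = r") auto
  have oth: "pend (Suc t) q = pend t q" if "q < k" "q \<noteq> r" for q
    using E(8)[OF that(1), of t] r that by simp
  obtain w where w: "pend (Suc t) r = Some w"
    "w = pos t r \<or> descends (pos t r) w \<and> w \<in> S \<and> w \<notin> far"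
    "pre t \<Longrightarrow> w = move (cfg t) (pos t r)"
    using look[OF I r] by metis
  have sq: "sq (Suc t) q" if "q < k" for q
  proof (cases "q = r")
    case True
    then show ?thesis using w same[OF rk] I rk by (auto simp: legal_def sq_def)
  next
    case False
    then show ?thesis using oth[OF that] same[OF that] I that by (auto simp: legal_def sq_def)
  qed
  have "legal_before_pile (Suc t)" if p1: "pre (Suc t)"
  proof -
    have p: "pre t" using p1 same by (auto simp: pre_def)
    have P: "legal_before_pile t" using I p by (simp add: legal_def)
    have K: "\<exists>s i. 0 < i \<and> pos t r = nd s i \<and> w = nd s (i - 1) \<and>
        (if unmoved t then r = ma s \<and> i = D else r = ml s \<or> r = ma s \<and> \<not> m s < D - 1)"
      if "w \<noteq> pos t r"
      using looker_mobile[OF I p rk] that w(3)[OF p] by metis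
    have side: "on_side (Suc t) s q i" if "on_side t s q i" "q < k" for s q i
    proof (cases "q = r")
      case False
      then show ?thesis using that same oth by (auto simp: on_side_def)
    next
      case True
      then have i: "0 < i" "pos t r = nd s i" using that by (auto simp: on_side_def)
      have "w = nd s i \<or> w = nd s (i - 1)"
      proof (cases "w = pos t r")
        case False
        then obtain s' i' where "0 < i'" "pos t r = nd s' i'" "w = nd s' (i' - 1)" using K by blast
        then show ?thesis using i nd_eq[OF i(1), of s s' i'] by auto
      qed (use i in simp)
      then show ?thesis using True i w(1) same[OF rk] by (auto simp: on_side_def)
    qed
    have st: "still (Suc t) q" if "still t q" "q < k" "q = r \<Longrightarrow> w = pos t r" for q
      using that same oth w(1) by (cases "q = r") (auto simp: still_def)
    have um: "unmoved (Suc t) \<longleftrightarrow> unmoved t" using same ma(1) by (simp add: unmoved_def)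
    show ?thesis
      unfolding legal_before_pile_def
    proof (intro conjI allI impI)
      show "lead (Suc t) s" for s
        using P side[OF _ ml(1)] unfolding legal_before_pile_def lead_def by blast
      show "tail (Suc t) s" for s
      proof -
        obtain i where i: "i \<le> D" "on_side t s (ma s) i"
          and c: "m s < D - 1 \<Longrightarrow> i = D \<or> i = D - 1 \<and> pend t (ma s) \<noteq> Some (nd s (i - 1))"
          using P unfolding legal_before_pile_def tail_def by blast
        have "pend (Suc t) (ma s) \<noteq> Some (nd s (i - 1))" if md: "m s < D - 1" and iD: "i \<noteq> D"
        proof (cases "ma s = r")
          case False
          then show ?thesis using c md iD oth[OF ma(1)] by auto
        next
          case True
          have i': "0 < i" "pos t r = nd s i" using i True by (auto simp: on_side_def)
          \<comment> \<open>At \<open>D - 1\<close> the corner robot is not enabled: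
            \<open>unmoved\<close> would place it at \<open>D\<close>, and it is its own leader only
            if \<open>m s = D\<close>.\<close>
          have "w = pos t r"
          proof (rule ccontr)
            assume "w \<noteq> pos t r"
            then obtain s' j where j: "pos t r = nd s' j"
              "if unmoved t then r = ma s' \<and> j = D else r = ml s' \<or> r = ma s' \<and> \<not> m s' < D - 1"
              using K by blast
            then have [simp]: "s' = s" "j = i" using i' nd_eq[OF i'(1), of s s' j] by auto
            have "r = ml s" using j(2) iD md by (auto split: if_splits)
            then have "nd s (m s) = nd s D" using True ml(2)[of s] ma(2)[of s] by simp
            then show False using md nd_eq[OF m(1)] by auto
          qed
          then show ?thesis using True w(1) i' nd_eq[OF i'(1), of s s "i - 1"] by auto
        qed
        then show ?thesis unfolding tail_def
          using i side[OF i(2) ma(1)] c by (intro exI[of _ i]) auto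
      qed
      show "still (Suc t) q" if "q < k" "q \<notin> mobile" for q
      proof (rule st)
        show "still t q" using P that by (simp add: legal_before_pile_def)
        show "w = pos t r" if "q = r"
        proof (rule ccontr)
          assume "w \<noteq> pos t r"
          from K[OF this] show False using \<open>q \<notin> mobile\<close> that by (auto simp: mobile_def split: if_splits)
        qed
      qed fact
      show "pos (Suc t) q = pos 0 q" if "unmoved (Suc t)" "q < k" for q
        using P that same um by (simp add: legal_before_pile_def)
      show "still (Suc t) q" if "unmoved (Suc t)" "q < k" "q \<notin> range ma" for q
      proof (rule st)
        show "still t q" using P that um by (simp add: legal_before_pile_def)
        show "w = pos t r" if "q = r"
        proof (rule ccontr)
          assume "w \<noteq> pos t r"
          from K[OF this] show False
            using \<open>q \<notin> range ma\<close> that um \<open>unmoved (Suc t)\<close> by auto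
        qed
      qed fact
    qed
  qed
  then show ?thesis using I sq same base(1) by (simp add: legal_def)
qed

text \<open>The look behind this move may be outdated, so only the recorded constraints on its
  destination are used.\<close>

lemma legal_step:
  assumes I: "legal t" and r: "act t = r" "pend t r = Some w"
  shows "legal (Suc t)"
proof -
  have rk: "r < k" using E(5) r by blast
  have oth: "pos (Suc t) q = pos t q" "pend (Suc t) q = pend t q" if "q < k" "q \<noteq> r" for q
    using E(7,8)[OF that(1), of t] r that by simp_all
  have new: "pos (Suc t) r = w" "pend (Suc t) r = None" using E(11,12)[of t w] r by auto
  have wr: "w = pos t r \<or> descends (pos t r) w \<and> w \<in> S \<and> w \<notin> far" and pS: "pos t r \<in> S"
    using I rk r unfolding legal_def sq_def by blast+
  \<comment> \<open>Both coordinates of the target are minimal in the square, so nobody can leave it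
    and a pile is never undone.\<close>
  have stay: "pos (Suc t) q = (lo, lo)" if "q < k" "pos t q = (lo, lo)" for q
    using oth[OF that(1)] that new wr descend_from_base[of w] by (cases "q = r") auto
  have far_back: "pos t q = pos (Suc t) q" if "q < k" "pos (Suc t) q \<in> far" for q
    using oth[OF that(1)] that new wr by (cases "q = r") auto
  have "sq (Suc t) q" if "q < k" for q
    using oth[OF that] that new wr pS I by (cases "q = r") (auto simp: legal_def sq_def)
  moreover have "pos 0 q = pos (Suc t) q" if "q < k" "pos (Suc t) q \<in> far" for q
    using I that far_back[OF that] by (auto simp: legal_def)
  moreover have "pos (Suc t) base = (lo, lo)" using stay base(1) I by (simp add: legal_def)
  moreover have "legal_before_pile (Suc t)" if p1: "pre (Suc t)"
  proof -
    have p: "pre t" using p1 stay by (auto simp: pre_def)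
    have P: "legal_before_pile t" using I p by (simp add: legal_def)
    \<comment> \<open>As the new state still has no pile, the executed step did not end at the
      target; this keeps the distances in \<open>on_side\<close> positive.\<close>
    have off: "pos (Suc t) q \<noteq> nd s 0" if "q < k" "q \<noteq> base" for q s
      using p1 that by (auto simp: pre_def)
    have st: "still (Suc t) q" if "still t q" "q < k" for q
      using that oth new r by (cases "q = r") (auto simp: still_def)
    have um: "unmoved t" if "unmoved (Suc t)"
      using that far_back[OF ma(1)] nd_D_far by (simp add: unmoved_def)
    show ?thesis
      unfolding legal_before_pile_def
    proof (intro conjI allI impI)
      show "lead (Suc t) s" for s
      proof -
        obtain i where i: "i \<le> m s" "on_side t s (ml s) i" using P unfolding legal_before_pile_def lead_def by blast
        show ?thesis
        proof (cases "ml s = r")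
          case False
          then show ?thesis using i oth[OF ml(1)] by (auto simp: lead_def on_side_def)
        next
          case True
          then have "w = nd s i \<or> w = nd s (i - 1)" using i r(2) by (auto simp: on_side_def)
          then obtain j where "j \<le> i" "w = nd s j" by (metis diff_le_self order_refl)
          moreover from this have "0 < j" using off[OF ml(1) ml_base, of s s] True new by (cases j) auto
          ultimately show ?thesis unfolding lead_def on_side_def
            using True new i(1) by (intro exI[of _ j]) auto
        qed
      qed
      show "tail (Suc t) s" for s
      proof -
        obtain i where i: "i \<le> D" "on_side t s (ma s) i"
          and c: "m s < D - 1 \<Longrightarrow> i = D \<or> i = D - 1 \<and> pend t (ma s) \<noteq> Some (nd s (i - 1))"
          using P unfolding legal_before_pile_def tail_def by blast
        show ?thesis
        proof (cases "ma s = r")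
          case False
          then have "on_side (Suc t) s (ma s) i" using i oth[OF ma(1)] by (auto simp: on_side_def)
          then show ?thesis unfolding tail_def
            using False i(1) c oth[OF ma(1)] by (intro exI[of _ i]) auto
        next
          case True
          then have "w = nd s i \<or> w = nd s (i - 1)" using i r(2) by (auto simp: on_side_def)
          then obtain j where j: "j \<le> i" "w = nd s j" "j = i \<or> j = i - 1"
            by (metis diff_le_self order_refl)
          moreover from this have "0 < j" using off[OF ma(1) ma_base, of s s] True new by (cases j) auto
          moreover have "j = D \<or> j = D - 1" if "m s < D - 1"
            using c[OF that] j True r(2) by auto
          ultimately show ?thesis unfolding tail_def on_side_def
            using True new i(1) by (intro exI[of _ j]) auto
        qed
      qed
      show "still (Suc t) q" if "q < k" "q \<notin> mobile" for q
        using st P that by (simp add: legal_before_pile_def)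
      show "pos (Suc t) q = pos 0 q" if u: "unmoved (Suc t)" and q: "q < k" for q
      proof (cases "q \<in> range ma")
        case True
        then show ?thesis using u ma(2) by (auto simp: unmoved_def) (metis (full_types))
      next
        case False
        then show ?thesis using st[of q] P um[OF u] q by (simp add: legal_before_pile_def still_def)
      qed
      show "still (Suc t) q" if "unmoved (Suc t)" "q < k" "q \<notin> range ma" for q
        using st P that um by (simp add: legal_before_pile_def)
    qed
  qed
  ultimately show ?thesis by (simp add: legal_def)
qed

lemma legal: "legal t"
proof (induction t)
  case (Suc t)
  then show ?case using legal_look[of t] legal_step[of t] by (cases "pend t (act t)") auto
qed (rule legal_0)

section \<open>Stabilisation and progress\<close>

lemma coord_sum_step: "r < k \<Longrightarrow> pos (Suc t) r = pos t r \<or> coord_sum (pos (Suc t) r) < coord_sum (pos t r)"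
proof -
  assume rk: "r < k"
  show ?thesis
  proof (cases "r = act t \<and> pend t r \<noteq> None")
    case True
    then obtain w where "pend t r = Some w" by blast
    then have w: "pend t r = Some w" "pos (Suc t) r = w" using E(11)[of t w] True by auto
    moreover have "sq t r" using legal rk by (simp add: legal_def)
    ultimately have "w = pos t r \<or> descends (pos t r) w" unfolding sq_def by blast
    then show ?thesis using w(2) by (auto simp: descends_def coord_sum_def)
  next
    case False
    then show ?thesis using E(7)[OF rk, of t] E(9)[of t] by metis
  qed
qed

lemma eventually_fixed: "\<exists>T. \<forall>t\<ge>T. \<forall>r<k. pos t r = pos T r"
proof -
  let ?H = "\<lambda>t. \<Sum>r<k. coord_sum (pos t r)"
  have le: "coord_sum (pos (Suc t) r) \<le> coord_sum (pos t r)" if "r < k" for t r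
    using coord_sum_step[OF that, of t] by auto
  have "?H (Suc t) \<le> ?H t" for t by (rule sum_mono) (use le in auto)
  then obtain T where T: "\<And>t. t \<ge> T \<Longrightarrow> ?H t = ?H T"
    using antimono_nat_eventually_const[of ?H] by blast
  have suc: "pos (Suc t) r = pos t r" if "t \<ge> T" "r < k" for t r
  proof (rule ccontr)
    assume "pos (Suc t) r \<noteq> pos t r"
    then have "coord_sum (pos (Suc t) r) < coord_sum (pos t r)" using coord_sum_step[OF that(2)] by blast
    then have "?H (Suc t) < ?H t" using le that(2) by (intro sum_strict_mono_ex1) auto
    then show False using T[of t] T[of "Suc t"] that(1) by simp
  qed
  have "pos t r = pos T r" if "t \<ge> T" "r < k" for t r
    using that(1) by (induction t rule: dec_induct) (use suc that(2) in auto)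
  then show ?thesis by blast
qed

lemma pend_until_active:
  assumes "r < k" "t \<le> t'" "\<And>i. t \<le> i \<Longrightarrow> i < t' \<Longrightarrow> act i \<noteq> r"
  shows "pend t' r = pend t r"
  using assms(2,3)
proof (induction t' rule: dec_induct)
  case (step i)
  have "act i \<noteq> r" using step.prems[of i] step.hyps by simp
  moreover have "pend i r = pend t r" using step.IH step.prems by (meson less_SucI)
  ultimately show ?case using E(8)[OF assms(1), of i] by simp
qed simp

lemma next_active:
  assumes "r < k" "non_crashed crash r"
  obtains t' where "t' \<ge> t" "act t' = r" "pend t' r = pend t r"
proof -
  let ?t = "LEAST t'. t' \<ge> t \<and> act t' = r"
  have t: "?t \<ge> t \<and> act ?t = r" using LeastI_ex[OF E(13)[OF assms, of t]] .
  have idle: "act i \<noteq> r" if "t \<le> i" "i < ?t" for i using not_less_Least[OF that(2)] that(1) by blast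
  have "pend ?t r = pend t r"
    by (rule pend_until_active[OF assms(1)]) (use t idle in blast)+
  then show ?thesis using that t by blast
qed

text \<open>A pending decision may be outdated, so the look that decides to stay is found at the second
  or third activation after the positions have stabilised.\<close>

lemma fixed_robot_looks:
  assumes fx: "\<And>t. t \<ge> T \<Longrightarrow> pos t r = pos T r" and r: "r < k" "non_crashed crash r"
  obtains t where "t \<ge> T" "act t = r" "pend t r = None" "pend (Suc t) r = Some (pos t r)"
proof -
  have "\<exists>t\<ge>T. act t = r \<and> pend t r = None"
  proof -
    obtain t1 where t1: "t1 \<ge> T" "act t1 = r" using next_active[OF r, of T] by blast
    show ?thesis
    proof (cases "pend t1 r")
      case None then show ?thesis using t1 by blast
    next
      case (Some w)
      then have "pend (Suc t1) r = None" using E(12)[of t1 w] t1 by simp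
      then show ?thesis using next_active[OF r, of "Suc t1"] t1(1) by (metis Suc_leD le_trans)
    qed
  qed
  then obtain t where t: "t \<ge> T" "act t = r" "pend t r = None" by blast
  obtain w where w: "pend (Suc t) r = Some w" using look[OF legal t(2,3)] by metis
  obtain t2 where t2: "t2 \<ge> Suc t" "act t2 = r" "pend t2 r = Some w"
    using next_active[OF r, of "Suc t"] w by metis
  have "pos (Suc t2) r = w" using E(11)[of t2 w] t2 by simp
  then have "w = pos t r" using fx[of "Suc t2"] fx[of t] t t2(1) by simp
  then show ?thesis using that t w by blast
qed

text \<open>Converse of \<open>move_before_pile\<close>: on an edge its necessary condition for
  moving is also sufficient.\<close>

lemma move_leader:
  assumes "f (lo, lo) \<noteq> 2" "0 < i"
    and "if f (hi, lo) \<noteq> 0 \<and> f (lo, hi) \<noteq> 0 then i = D else \<forall>j. 0 < j \<and> j < i \<longrightarrow> f (nd s j) = 0"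
  shows "move f (nd s i) = nd s (i - 1)"
proof (cases "f (hi, lo) \<noteq> 0 \<and> f (lo, hi) \<noteq> 0")
  case True
  then have "i = D" using assms(3) unfolding if_P[OF True] by simp
  then show ?thesis using True assms(1) D hi(1) by (cases s) (simp_all add: nd_D, simp_all add: nd_def move.simps)
next
  case False
  then have z: "f (nd s j) = 0" if "0 < j" "j < i" for j using assms(3) that unfolding if_not_P[OF False] by blast
  show ?thesis
  proof (cases s)
    case True
    have "(\<forall>j. lo < j \<and> j < lo + i \<longrightarrow> f (lo, j) = 0) \<longleftrightarrow> True"
    proof (intro iffI allI impI TrueI)
      fix j assume "lo < j \<and> j < lo + i"
      then show "f (lo, j) = 0" using z[of "j - lo"] True by (auto simp: nd_def less_diff_conv2)
    qed
    from this True False assms(1,2) show ?thesis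
      unfolding nd_def if_P[OF True] move.simps by (simp only:) auto
  next
    case s: False
    have "(\<forall>j. lo < j \<and> j < lo + i \<longrightarrow> f (j, lo) = 0) \<longleftrightarrow> True"
    proof (intro iffI allI impI TrueI)
      fix j assume "lo < j \<and> j < lo + i"
      then show "f (j, lo) = 0" using z[of "j - lo"] s by (auto simp: nd_def less_diff_conv2)
    qed
    from this s False assms(1,2) show ?thesis
      unfolding nd_def if_not_P[OF s] move.simps by (simp only:) auto
  qed
qed

text \<open>Used for both values of \<open>s\<close>, this gives two different robots that want to
  move, at most one of them crashed. A nearest occupied edge node exists because before the pile the
  leader remains on its edge.\<close>

lemma leader_exists:
  assumes "pre t"
  shows "\<exists>r<k. \<exists>i>0. pos t r = nd s i \<and> move (cfg t) (pos t r) \<noteq> pos t r"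
proof -
  have P: "legal_before_pile t" using legal assms by (simp add: legal_def)
  have f: "cfg t (lo, lo) \<noteq> 2" using base_count[OF legal] assms by simp
  have ne: "nd s (i - 1) \<noteq> nd s i" if "0 < i" for i
  proof -
    have "coord_sum (nd s (i - 1)) \<noteq> coord_sum (nd s i)" using that unfolding coord_sum_nd by arith
    then show ?thesis by metis
  qed
  show ?thesis
  proof (cases "unmoved t")
    case True
    then have "pos t (ma s) = nd s D" by (cases s) (auto simp: unmoved_def)
    moreover have "move (cfg t) (nd s D) = nd s (D - 1)"
      using True f D(1) unmoved_iff[OF legal, of t] by (intro move_leader) auto
    ultimately show ?thesis using ne[of D] D(1) ma(1)
      by (intro exI[of _ "ma s"] conjI exI[of _ D]) auto
  next
    case False
    let ?Q = "\<lambda>i. 0 < i \<and> cfg t (nd s i) \<noteq> 0"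
    obtain j where "0 < j" "pos t (ml s) = nd s j" using P lead_pos by (metis legal_before_pile_def)
    then have "?Q j" using ml(1) by (auto simp: config_of_eq_0)
    then have i: "?Q (Least ?Q)" by (rule LeastI)
    have least: "cfg t (nd s j) = 0" if "0 < j" "j < Least ?Q" for j
      using not_less_Least[OF that(2)] that(1) by blast
    obtain r where r: "r < k" "pos t r = nd s (Least ?Q)" using i by (auto simp: config_of_eq_0)
    have "move (cfg t) (nd s (Least ?Q)) = nd s (Least ?Q - 1)"
      using False f i unmoved_iff[OF legal, of t] least by (intro move_leader) auto
    then show ?thesis using r i ne[of "Least ?Q"] 
      by (intro exI[of _ r] conjI exI[of _ "Least ?Q"]) auto
  qed
qed

lemma gathers: "\<exists>T v. \<forall>t\<ge>T. \<forall>r<k. non_crashed crash r \<longrightarrow> pos t r = v"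
proof -
  obtain T where T: "\<And>t r. t \<ge> T \<Longrightarrow> r < k \<Longrightarrow> pos t r = pos T r" using eventually_fixed by blast
  have c: "cfg t = cfg T" and pr: "pre t \<longleftrightarrow> pre T" if "t \<ge> T" for t
  proof -
    have "{r. r < k \<and> pos t r = v} = {r. r < k \<and> pos T r = v}" for v using T[OF that] by auto
    then show "cfg t = cfg T" by (simp add: config_of_def fun_eq_iff)
    show "pre t \<longleftrightarrow> pre T" using T[OF that] by (auto simp: pre_def)
  qed
  have "\<not> pre T"
  proof
    assume p: "pre T"
    obtain r0 i0 where r0: "r0 < k" "i0 > 0" "pos T r0 = nd False i0"
      "move (cfg T) (pos T r0) \<noteq> pos T r0" using leader_exists[OF p] by metis
    obtain r1 i1 where r1: "r1 < k" "i1 > 0" "pos T r1 = nd True i1"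
      "move (cfg T) (pos T r1) \<noteq> pos T r1" using leader_exists[OF p] by metis
    have "r0 \<noteq> r1" using r0 r1 nd_eq[OF r0(2), of False True i1] by auto
    then have "non_crashed crash r0 \<or> non_crashed crash r1"
      by (auto simp: non_crashed_def split: option.splits)
    then obtain r where r: "r < k" "non_crashed crash r" "move (cfg T) (pos T r) \<noteq> pos T r"
      using r0 r1 by blast
    obtain t where t: "t \<ge> T" "act t = r" "pend t r = None" "pend (Suc t) r = Some (pos t r)"
      using fixed_robot_looks[OF T[OF _ r(1)] r(1,2)] by blast
    have "pos t r = move (cfg t) (pos t r)"
      using look[OF legal t(2,3)] t(4) pr[OF t(1)] p by (metis option.inject)
    then show False using r(3) c[OF t(1)] T[OF t(1) r(1)] by simp
  qed
  \<comment> \<open>With a pile, only a robot already at the target decides to stay.\<close>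
  have "pos t r = (lo, lo)" if tr: "t \<ge> T" "r < k" "non_crashed crash r" for t r
  proof -
    obtain t' where t': "t' \<ge> T" "act t' = r" "pend t' r = None" "pend (Suc t') r = Some (pos t' r)"
      using fixed_robot_looks[OF T[OF _ tr(2)] tr(2,3)] by blast
    have "pos t' r = (lo, lo)"
      using look[OF legal t'(2,3)] t'(4) pr[OF t'(1)] \<open>\<not> pre T\<close> by (metis option.inject)
    then show ?thesis using T tr t'(1) by metis
  qed
  then show ?thesis by blast
qed

end

lemma (in normal_form) gatherable: "gatherable_one_crash n k f0"
  unfolding gatherable_one_crash_def
proof (intro exI[of _ alg] conjI allI impI)
  show "valid_alg n alg" by (rule alg_valid)
  fix pos pend act crash
  assume "lcm_execution n alg k f0 pos pend act crash"
  then interpret run n lo f0 k pos pend act crash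
    by unfold_locales
  show "\<exists>T v. \<forall>t\<ge>T. \<forall>r<k. non_crashed crash r \<longrightarrow> pos t r = v" by (rule gathers)
qed

section \<open>Reduction to the normal form\<close>

definition symmetric :: "nat \<Rightarrow> config \<Rightarrow> bool \<Rightarrow> bool \<Rightarrow> bool \<Rightarrow> bool" where
  "symmetric n f s a b \<longleftrightarrow> (\<forall>v\<in>grid_nodes n. f (sym_map n s a b v) = f v)"

lemma symmetricI: "(\<And>x y. x < n \<Longrightarrow> y < n \<Longrightarrow> f (sym_map n s a b (x, y)) = f (x, y)) \<Longrightarrow> symmetric n f s a b"
  by (auto simp: symmetric_def)

lemma symmetricD: "symmetric n f s a b \<Longrightarrow> x < n \<Longrightarrow> y < n \<Longrightarrow> f (sym_map n s a b (x, y)) = f (x, y)"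
  by (simp add: symmetric_def)

text \<open>Only the identity and the reflection in the main diagonal remain; both fix every
  \<open>(d, d)\<close>.\<close>

definition diagonal_only :: "nat \<Rightarrow> config \<Rightarrow> bool" where
  "diagonal_only n f \<longleftrightarrow> (\<forall>s a b. symmetric n f s a b \<longrightarrow> \<not> a \<and> \<not> b)"

text \<open>The condition on \<open>s\<close>, \<open>a\<close>, \<open>b\<close> lists the axis
  reflections, the half-turn and the quarter turns. For even \<open>n\<close> the first two kinds
  are involutions without fixed nodes, and a quarter turn squares to the half-turn.\<close>

lemma symmetric_partitive:
  assumes "even n" "n > 0" and inv: "symmetric n f s a b" and ab: "a \<noteq> b \<or> (\<not> s \<and> a)"
  shows "partitive n f"
proof -
  have odd: "n - 1 - x \<noteq> x" if "x < n" for x using assms(1) that by presburger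
  have inv': "f (sym_map n s a b v) = f v" if "v \<in> grid_nodes n" for v
    using inv that by (simp add: symmetric_def)
  show ?thesis
  proof (cases s)
    case False
    show ?thesis
    proof (rule partitive_of_order2[of n "sym_map n s a b" f, OF sym_map_grid_aut inv' assms(2)])
      fix v assume v: "v \<in> grid_nodes n"
      show "sym_map n s a b (sym_map n s a b v) = v"
        using v False by (cases v) (auto simp: sym_map_def)
      obtain x y where xy: "v = (x, y)" by fastforce
      then have "n - 1 - x \<noteq> x" "n - 1 - y \<noteq> y" using v odd by auto
      then show "sym_map n s a b v \<noteq> v"
        using ab False xy by (cases a; cases b) (auto simp: sym_map_def)
    qed
  next
    case True
    then have ab: "a \<noteq> b" using ab by simp
    have sq: "sym_map n s a b (sym_map n s a b (x, y)) = (n - 1 - x, n - 1 - y)" if "x < n" "y < n" for x y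
      using ab True that by (cases a; cases b) (auto simp: sym_map_def)
    show ?thesis
    proof (rule partitive_of_order4[of n "sym_map n s a b" f, OF sym_map_grid_aut inv' assms(2)])
      fix v assume v: "v \<in> grid_nodes n"
      obtain x y where xy: "v = (x, y)" by fastforce
      then have l: "x < n" "y < n" using v by auto
      then show "sym_map n s a b (sym_map n s a b (sym_map n s a b (sym_map n s a b v))) = v"
        unfolding xy sq[OF l] by (subst sq) auto
      show "sym_map n s a b (sym_map n s a b v) \<noteq> v"
        unfolding xy sq[OF l] using odd[OF l(1)] by simp
    qed
  qed
qed

text \<open>This is conjugation in the dihedral group: a reflection in one axis
  (\<open>c \<noteq> d\<close>) exchanges the two diagonal reflections and the two quarter turns,
  while the half-turn is central.\<close>

lemma symmetric_view_flip:
  assumes "symmetric n (view n (sym_map n False c d) f) s a b"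
  shows "symmetric n f s (if s then a \<noteq> (c \<noteq> d) else a) (if s then b \<noteq> (c \<noteq> d) else b)"
proof (rule symmetricI)
  fix x y assume l: "x < n" "y < n"
  let ?\<tau> = "sym_map n False c d"
  let ?\<sigma> = "sym_map n s a b"
  have g: "?\<tau> (x, y) \<in> grid_nodes n" using grid_aut_mem[OF sym_map_grid_aut] l by simp
  then have g': "?\<sigma> (?\<tau> (x, y)) \<in> grid_nodes n" using grid_aut_mem[OF sym_map_grid_aut] by blast
  have "view n ?\<tau> f (?\<sigma> (?\<tau> (x, y))) = view n ?\<tau> f (?\<tau> (x, y))"
    using assms g unfolding symmetric_def by blast
  then have "f (?\<tau> (?\<sigma> (?\<tau> (x, y)))) = f (?\<tau> (?\<tau> (x, y)))" using g g' by (simp add: view_def)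
  moreover have "?\<tau> (?\<tau> (x, y)) = (x, y)" using l by (auto simp: sym_map_def)
  moreover have "?\<tau> (?\<sigma> (?\<tau> (x, y))) =
      sym_map n s (if s then a \<noteq> (c \<noteq> d) else a) (if s then b \<noteq> (c \<noteq> d) else b) (x, y)"
    using l by (cases s; cases a; cases b; cases c; cases d) (simp_all add: sym_map_def)
  ultimately show "f (sym_map n s (if s then a \<noteq> (c \<noteq> d) else a) (if s then b \<noteq> (c \<noteq> d) else b) (x, y)) = f (x, y)"
    by simp
qed

text \<open>If the antidiagonal is an axis, an axis reflection turns it into the main diagonal. Both
  diagonals cannot be axes, since the product of the two reflections is the half-turn.\<close>

lemma diagonal_only_flip:
  assumes "even n" "n > 0" "\<not> partitive n f"
  shows "diagonal_only n f \<or> diagonal_only n (view n (sym_map n False True False) f)"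
proof (cases "symmetric n f True True True")
  case False
  then have "\<not> a \<and> \<not> b" if "symmetric n f s a b" for s a b
    using symmetric_partitive[OF assms(1,2) that] assms(3) that by (cases s; cases a; cases b) auto
  then show ?thesis by (auto simp: diagonal_only_def)
next
  case True
  have no: "\<not> symmetric n f True False False"
  proof
    assume d: "symmetric n f True False False"
    have "symmetric n f False True True"
    proof (rule symmetricI)
      fix x y assume l: "x < n" "y < n"
      show "f (sym_map n False True True (x, y)) = f (x, y)"
        using symmetricD[OF True l(2,1)] symmetricD[OF d l] by (simp add: sym_map_def)
    qed
    then show False using symmetric_partitive[OF assms(1,2)] assms(3) by blast
  qed
  have "\<not> a \<and> \<not> b" if "symmetric n (view n (sym_map n False True False) f) s a b" for s a b
    using symmetric_partitive[OF assms(1,2) symmetric_view_flip[OF that]] assms(3)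
      symmetric_view_flip[OF that] no
    by (cases s; cases a; cases b) auto
  then show ?thesis by (auto simp: diagonal_only_def)
qed

section \<open>Choice of the target end and of the enclosing square\<close>

definition framed :: "nat \<Rightarrow> nat \<Rightarrow> config \<Rightarrow> bool" where
  "framed n d f \<longleftrightarrow> (\<forall>v. f v \<noteq> 0 \<longrightarrow> v \<in> centered_square n d) \<and>
     (\<forall>x\<in>{d, n - 1 - d}. \<forall>y\<in>{d, n - 1 - d}. f (x, y) = 1)"

lemma framed_flip:
  assumes f: "framed n d f" and d: "2 * d < n"
  shows "framed n d (view n (sym_map n False a b) f)"
proof -
  have "v \<in> centered_square n d" if "view n (sym_map n False a b) f v \<noteq> 0" for v
  proof -
    obtain x y where xy: "v = (x, y)" by fastforce
    have l: "x < n" "y < n" using that xy by (auto simp: view_def split: if_splits)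
    have "f (sym_map n False a b v) \<noteq> 0" using that by (simp add: view_def split: if_splits)
    then have "sym_map n False a b v \<in> centered_square n d" using f unfolding framed_def by blast
    then show ?thesis using l d xy
      by (cases a; cases b) (auto simp: sym_map_def centered_square_def)
  qed
  moreover have "view n (sym_map n False a b) f (x, y) = 1"
    if "x \<in> {d, n - 1 - d}" "y \<in> {d, n - 1 - d}" for x y
  proof -
    have "x < n" "y < n" using that d by auto
    moreover have "fst (sym_map n False a b (x, y)) \<in> {d, n - 1 - d}"
      "snd (sym_map n False a b (x, y)) \<in> {d, n - 1 - d}"
      using that d by (auto simp: sym_map_def)
    ultimately show ?thesis using f unfolding framed_def view_def by (metis mem_grid prod.collapse)
  qed
  ultimately show ?thesis by (simp add: framed_def)
qed

lemma gatherable_flip: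
  assumes "gatherable_one_crash n k (view n (sym_map n False a b) f)"
  shows "gatherable_one_crash n k f"
proof (rule gatherable_relabel[OF sym_map_grid_aut _ assms])
  show "sym_map n False a b (sym_map n False a b v) = v" if "v \<in> grid_nodes n" for v
    using that by (cases v; cases a; cases b) (auto simp: sym_map_def)
qed

lemma gatherable_balanced:
  assumes "framed n d f" "2 * d + 3 \<le> n" "diagonal_only n f" "weight n f \<le> (n - 1) * total_count n f"
  shows "gatherable_one_crash n k f"
proof -
  interpret normal_form n d f
  proof
    show "2 * d + 3 \<le> n" by fact
    show "v \<in> centered_square n d" if "f v \<noteq> 0" for v using assms(1) that unfolding framed_def by blast
    show "f (d, d) = 1" "f (n - 1 - d, d) = 1" "f (d, n - 1 - d) = 1" "f (n - 1 - d, n - 1 - d) = 1"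
      using assms(1) by (auto simp: framed_def)
    show "weight n f \<le> (n - 1) * total_count n f" by fact
    fix \<psi> assume \<psi>: "grid_aut n \<psi>" "\<And>v. v \<in> grid_nodes n \<Longrightarrow> f (\<psi> v) = f v"
    obtain s a b where s: "\<And>v. v \<in> grid_nodes n \<Longrightarrow> \<psi> v = sym_map n s a b v"
      using grid_aut_sym_map[OF \<psi>(1)] by metis
    have "symmetric n f s a b" using \<psi>(2) s by (simp add: symmetric_def)
    then have "\<not> a \<and> \<not> b" using assms(3) unfolding diagonal_only_def by blast
    then show "\<psi> (d, d) = (d, d)" using s[of "(d, d)"] assms(2) by (simp add: sym_map_def)
  qed
  show ?thesis by (rule gatherable)
qed

text \<open>If the opposite end has the smaller distance sum, the half-turn exchanges the ends;
  being central, it preserves \<open>diagonal_only\<close>.\<close>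

lemma gatherable_diagonal_only:
  assumes "framed n d f" "2 * d + 3 \<le> n" "diagonal_only n f"
  shows "gatherable_one_crash n k f"
proof (cases "weight n f \<le> (n - 1) * total_count n f")
  case True
  then show ?thesis using gatherable_balanced assms by blast
next
  case False
  let ?\<tau> = "sym_map n False True True"
  have "weight n (view n ?\<tau> f) + weight n f = 2 * (n - 1) * total_count n f"
    by (rule weight_view_antipodal[OF sym_map_grid_aut])
      (auto simp: coord_sum_def sym_map_def grid_nodes_def)
  then have "weight n (view n ?\<tau> f) \<le> (n - 1) * total_count n (view n ?\<tau> f)"
    using False total_count_view[OF sym_map_grid_aut, of n False True True f] by simp
  moreover have "diagonal_only n (view n ?\<tau> f)"
    unfolding diagonal_only_def
  proof (intro allI impI)
    fix s a b assume "symmetric n (view n ?\<tau> f) s a b"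
    from symmetric_view_flip[OF this] have "symmetric n f s a b" by (cases s; cases a; cases b) simp_all
    then show "\<not> a \<and> \<not> b" using assms(3) unfolding diagonal_only_def by blast
  qed
  ultimately have "gatherable_one_crash n k (view n ?\<tau> f)"
    using gatherable_balanced[OF framed_flip[OF assms(1)] assms(2)] assms(2) by simp
  then show ?thesis by (rule gatherable_flip)
qed

lemma mes_offset_encloses:
  assumes "n > 1"
  shows "mes_offset n f < n div 2"
    and "v \<in> grid_nodes n \<Longrightarrow> f v \<noteq> 0 \<Longrightarrow> v \<in> centered_square n (mes_offset n f)"
proof -
  let ?P = "\<lambda>d. d < n div 2 \<and> (\<forall>v\<in>grid_nodes n. f v \<noteq> 0 \<longrightarrow> v \<in> centered_square n d)"
  \<comment> \<open>Offset 0 is the whole grid, so \<open>GREATEST\<close> ranges over a nonempty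
    bounded set.\<close>
  have "?P 0" using assms by (auto simp: centered_square_def)
  then have "?P (mes_offset n f)"
    unfolding mes_offset_def by (rule GreatestI_nat[where b = "n div 2"]) simp
  then show "mes_offset n f < n div 2"
    "v \<in> grid_nodes n \<Longrightarrow> f v \<noteq> 0 \<Longrightarrow> v \<in> centered_square n (mes_offset n f)" by blast+
qed

theorem theorem10:
  fixes n k :: nat and f0 :: config
  assumes "even n"
    and "k \<ge> 3"
    and "\<forall>v. v \<notin> grid_nodes n \<longrightarrow> f0 v = 0"
    and "\<forall>v\<in>grid_nodes n. f0 v \<le> 1"
    and "card {v \<in> grid_nodes n. f0 v = 1} = k"
    and "\<not> partitive n f0"
    and "\<forall>c\<in>mes_corners n f0. f0 c \<noteq> 0"
  shows "gatherable_one_crash n k f0"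
proof -
  have "n \<noteq> 0" using assms(2,5) by (intro notI) (simp add: grid_nodes_def)
  then have n: "n > 1" "n > 0" using assms(1) by presburger+
  define d where "d = mes_offset n f0"
  have d: "d < n div 2" using mes_offset_encloses(1)[OF n(1)] by (simp add: d_def)
  have supp: "v \<in> centered_square n d" if "f0 v \<noteq> 0" for v
  proof -
    have "v \<in> grid_nodes n" using assms(3) that by metis
    then show ?thesis using mes_offset_encloses(2)[OF n(1)] that unfolding d_def by blast
  qed
  have cor: "f0 (x, y) = 1" if "x \<in> {d, n - 1 - d}" "y \<in> {d, n - 1 - d}" for x y
  proof -
    have "(x, y) \<in> mes_corners n f0" using that by (auto simp: mes_corners_def d_def Let_def)
    then have "f0 (x, y) \<noteq> 0" using assms(7) by blast
    moreover have "(x, y) \<in> grid_nodes n" using that d by auto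
    moreover from this have "f0 (x, y) \<le> 1" using assms(4) by blast
    ultimately show ?thesis by linarith
  qed
  have fr: "framed n d f0" using supp cor unfolding framed_def by blast
  \<comment> \<open>A two-by-two square consists of its corners alone; with all of them occupied the
    half-turn would be a symmetry.\<close>
  have "2 * d + 2 \<noteq> n"
  proof
    assume e: "2 * d + 2 = n"
    have f: "f0 (x, y) = (if x \<in> {d, n - 1 - d} \<and> y \<in> {d, n - 1 - d} then 1 else 0)" for x y
    proof (cases "x \<in> {d, n - 1 - d} \<and> y \<in> {d, n - 1 - d}")
      case False
      then have "(x, y) \<notin> centered_square n d" using e by (auto simp: centered_square_def)
      then show ?thesis using supp[of "(x, y)"] False by auto
    qed (use cor in auto)
    have "symmetric n f0 False True True"
      by (rule symmetricI) (use e in \<open>auto simp: f sym_map_def\<close>)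
    then show False using symmetric_partitive[OF assms(1) n(2)] assms(6) by blast
  qed
  then have d3: "2 * d + 3 \<le> n" using d assms(1) by auto
  show ?thesis
    using diagonal_only_flip[OF assms(1) n(2) assms(6)]
  proof
    assume "diagonal_only n f0"
    then show ?thesis using gatherable_diagonal_only fr d3 by blast
  next
    assume "diagonal_only n (view n (sym_map n False True False) f0)"
    then have "gatherable_one_crash n k (view n (sym_map n False True False) f0)"
      using gatherable_diagonal_only[OF framed_flip[OF fr] d3] d3 by simp
    then show ?thesis by (rule gatherable_flip)
  qed
qed

end
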